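(* Let $G$ be a generator signature of arity $n$ on domain size $3$ of full rank. Then for every $\ell\geq 1$ and every $2^{\ell}\times 3$ complex matrix $M$ of rank $3$, $G$ cannot be realized on $M$; that is, $M^{\otimes n}G$ is not the standard signature of any generator matchgate.
   Context: A matchgate is a planar graph $H$ with complex edge weights together with designated output nodes on the outer face (labelled in counterclockwise order); a generator matchgate has only output nodes. Its standard signature is the vector in $\mathbb{C}^{2^{m}}$ ($m$ the number of output nodes) whose entry indexed by $i_{1}\cdots i_{m}\in\{0,1\}^{m}$ (lexicographic order) is the sum over perfect matchings of $H-Z$ of the product of edge weights, where $Z$ is the set of output nodes $j$ with $i_{j}=1$. A generator signature of arity $n$ on domain size $k$ is $G=(G^{j_{1}\cdots j_{n}})\in\mathbb{C}^{k^{n}}$; $G(t)$ is the $k\times k^{n-1}$ matrix with rows indexed by $j_{t}$ and columns by the remaining indices in lexicographic order. $G$ is degenerate if $G=\gamma_{1}\otimes\cdots\otimes\gamma_{n}$ with $\gamma_{i}\in\mathbb{C}^{k}$, and of full rank if not degenerate and $\mathrm{rank}\,G(t)=k$ for some $t$. $G$ is realized on a $2^{\ell}\times k$ matrix $M$ if $M^{\otimes n}G$ is the standard signature of a generator matchgate. *)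

theory Defs
  imports "HOL-Analysis.Analysis" "Jordan_Normal_Form.DL_Rank"
begin

text \<open>
  Tensors in \<open>\<complex>\<^bsup>k^n\<^esup>\<close> are vectors of dimension \<open>k ^ n\<close> whose entries are indexed by the words of
  length \<open>n\<close> over \<open>{0..<k}\<close> in lexicographic order: a word is numbered by reading it as a
  base-\<open>k\<close> numeral, first letter most significant.
\<close>

definition lex_index :: "nat \<Rightarrow> nat list \<Rightarrow> nat" where
  "lex_index k js = foldl (\<lambda>a j. a * k + j) 0 js"

definition lex_word :: "nat \<Rightarrow> nat \<Rightarrow> nat \<Rightarrow> nat list" where
  "lex_word k n c = map (\<lambda>s. c div k ^ (n - 1 - s) mod k) [0..<n]"

lemma length_lex_word [simp]: "length (lex_word k n c) = n"
  by (simp add: lex_word_def)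

lemma lex_index_snoc: "lex_index k (js @ [j]) = lex_index k js * k + j"
  by (simp add: lex_index_def)

lemma lex_word_Suc: "lex_word k (Suc n) c = lex_word k n (c div k) @ [c mod k]"
proof (rule nth_equalityI)
  fix i assume "i < length (lex_word k (Suc n) c)"
  then have i: "i < Suc n" by simp
  show "lex_word k (Suc n) c ! i = (lex_word k n (c div k) @ [c mod k]) ! i"
  proof (cases "i = n")
    case True then show ?thesis by (simp add: lex_word_def nth_append del: upt_Suc)
  next
    case False
    then have "n - i = Suc (n - 1 - i)" using i by simp
    then show ?thesis using False i
      by (simp add: lex_word_def nth_append div_mult2_eq del: upt_Suc)
  qed
qed simp

lemma lex_index_lex_word: "c < k ^ n \<Longrightarrow> lex_index k (lex_word k n c) = c"
proof (induction n arbitrary: c)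
  case 0 then show ?case by (simp add: lex_word_def lex_index_def)
next
  case (Suc n)
  then have "c div k < k ^ n" by (simp add: less_mult_imp_div_less mult.commute)
  with Suc show ?case by (simp add: lex_word_Suc lex_index_snoc)
qed

text \<open>Kronecker products, compatible with the lexicographic numbering above.\<close>

definition kron_vec :: "complex Matrix.vec \<Rightarrow> complex Matrix.vec \<Rightarrow> complex Matrix.vec" where
  "kron_vec u v = Matrix.vec (dim_vec u * dim_vec v)
     (\<lambda>i. vec_index u (i div dim_vec v) * vec_index v (i mod dim_vec v))"

definition kron_mat :: "complex mat \<Rightarrow> complex mat \<Rightarrow> complex mat" where
  "kron_mat A B = Matrix.mat (dim_row A * dim_row B) (dim_col A * dim_col B)
     (\<lambda>(i, j). A $$ (i div dim_row B, j div dim_col B) * B $$ (i mod dim_row B, j mod dim_col B))"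

definition tensor_vecs :: "complex Matrix.vec list \<Rightarrow> complex Matrix.vec" where
  "tensor_vecs us = foldr kron_vec us (Matrix.vec 1 (\<lambda>_. 1))"

definition tensor_power :: "complex mat \<Rightarrow> nat \<Rightarrow> complex mat" where
  "tensor_power M n = (kron_mat M ^^ n) (1\<^sub>m 1)"

definition degenerate :: "nat \<Rightarrow> nat \<Rightarrow> complex Matrix.vec \<Rightarrow> bool" where
  "degenerate k n G \<longleftrightarrow>
     (\<exists>us. length us = n \<and> set us \<subseteq> carrier_vec k \<and> G = tensor_vecs us)"

text \<open>
  The positions \<open>t\<close> of a signature of arity \<open>n\<close> are counted from \<open>0\<close>; a column of the unfolding
  at \<open>t\<close> is a word of length \<open>n - 1\<close>, into which the row index is inserted at position \<open>t\<close>.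
\<close>

definition unfolding_mat ::
    "nat \<Rightarrow> nat \<Rightarrow> complex Matrix.vec \<Rightarrow> nat \<Rightarrow> complex mat" where
  "unfolding_mat k n G t = Matrix.mat k (k ^ (n - 1))
     (\<lambda>(j, c). let js = lex_word k (n - 1) c
               in vec_index G (lex_index k (take t js @ [j] @ drop t js)))"

definition full_rank_signature :: "nat \<Rightarrow> nat \<Rightarrow> complex Matrix.vec \<Rightarrow> bool" where
  "full_rank_signature k n G \<longleftrightarrow>
     \<not> degenerate k n G \<and> (\<exists>t<n. vec_space.rank k (unfolding_mat k n G t) = k)"

text \<open>
  Generators only: a simple graph (edges are two-element sets of vertices) with output nodes
  \<open>outs\<close> and no input nodes.
\<close>

record 'v gate =
  verts :: "'v set"
  edges :: "'v set set"
  weight :: "'v set \<Rightarrow> complex"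
  outs :: "'v list"

definition wf_gate :: "'v gate \<Rightarrow> bool" where
  "wf_gate H \<longleftrightarrow> finite (verts H) \<and> (\<forall>e\<in>edges H. e \<subseteq> verts H \<and> card e = 2) \<and>
     distinct (outs H) \<and> set (outs H) \<subseteq> verts H"

text \<open>
  A drawing places each vertex \<open>v\<close> at \<open>p v\<close> and each edge \<open>e\<close> along the simple arc \<open>\<gamma> e\<close>.
\<close>

definition drawing :: "'v gate \<Rightarrow> ('v \<Rightarrow> complex) \<Rightarrow> ('v set \<Rightarrow> real \<Rightarrow> complex) \<Rightarrow> complex set" where
  "drawing H p \<gamma> = p ` verts H \<union> (\<Union>e\<in>edges H. path_image (\<gamma> e))"

definition plane_embedding :: "'v gate \<Rightarrow> ('v \<Rightarrow> complex) \<Rightarrow> ('v set \<Rightarrow> real \<Rightarrow> complex) \<Rightarrow> bool" where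
  "plane_embedding H p \<gamma> \<longleftrightarrow>
     inj_on p (verts H) \<and>
     (\<forall>e\<in>edges H. arc (\<gamma> e) \<and> {pathstart (\<gamma> e), pathfinish (\<gamma> e)} = p ` e \<and>
        path_image (\<gamma> e) \<inter> p ` verts H = p ` e) \<and>
     (\<forall>e\<in>edges H. \<forall>f\<in>edges H. e \<noteq> f \<longrightarrow> path_image (\<gamma> e) \<inter> path_image (\<gamma> f) \<subseteq> p ` (e \<inter> f))"

definition outer_face :: "'v gate \<Rightarrow> ('v \<Rightarrow> complex) \<Rightarrow> ('v set \<Rightarrow> real \<Rightarrow> complex) \<Rightarrow> complex set" where
  "outer_face H p \<gamma> = outside (drawing H p \<gamma>)"

text \<open>
  The output nodes lie on the boundary of the outer face. The counterclockwise order is expressed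
  by dangling external edges: the output nodes can be joined, by pairwise disjoint arcs running
  through the outer face, to points that appear in counterclockwise order on a large circle around
  the graph. This remains meaningful when the outer boundary is not a simple closed curve (cut
  vertices, several components), where it allows each order in which such external edges can be
  attached.
\<close>

definition outs_counterclockwise ::
    "'v gate \<Rightarrow> ('v \<Rightarrow> complex) \<Rightarrow> ('v set \<Rightarrow> real \<Rightarrow> complex) \<Rightarrow> bool" where
  "outs_counterclockwise H p \<gamma> \<longleftrightarrow>
     (\<exists>r (\<alpha> :: nat \<Rightarrow> real \<Rightarrow> complex) (\<theta> :: nat \<Rightarrow> real).
        drawing H p \<gamma> \<subseteq> ball 0 r \<and>
        (\<forall>i<length (outs H).
           arc (\<alpha> i) \<and> pathstart (\<alpha> i) = p (outs H ! i) \<and>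
           pathfinish (\<alpha> i) = of_real r * cis (\<theta> i) \<and>
           path_image (\<alpha> i) - {pathstart (\<alpha> i)} \<subseteq> outer_face H p \<gamma> \<and>
           path_image (\<alpha> i) - {pathfinish (\<alpha> i)} \<subseteq> ball 0 r) \<and>
        (\<forall>i<length (outs H). \<forall>j<length (outs H).
           i \<noteq> j \<longrightarrow> path_image (\<alpha> i) \<inter> path_image (\<alpha> j) = {}) \<and>
        (\<forall>i<length (outs H). \<forall>j<length (outs H).
           i < j \<longrightarrow> \<theta> i < \<theta> j \<and> \<theta> j < \<theta> i + 2 * pi))"

definition generator_matchgate :: "'v gate \<Rightarrow> bool" where
  "generator_matchgate H \<longleftrightarrow> wf_gate H \<and>
     (\<exists>p \<gamma>. plane_embedding H p \<gamma> \<and> (\<forall>v\<in>set (outs H). p v \<in> frontier (outer_face H p \<gamma>)) \<and>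
       outs_counterclockwise H p \<gamma>)"

definition del_verts :: "'v gate \<Rightarrow> 'v set \<Rightarrow> 'v gate" where
  "del_verts H Z = H\<lparr>verts := verts H - Z, edges := {e \<in> edges H. e \<inter> Z = {}},
     outs := filter (\<lambda>v. v \<notin> Z) (outs H)\<rparr>"

definition perfect_matchings :: "'v gate \<Rightarrow> 'v set set set" where
  "perfect_matchings H = {F. F \<subseteq> edges H \<and> (\<forall>v\<in>verts H. \<exists>!e. e \<in> F \<and> v \<in> e)}"

definition perf_match :: "'v gate \<Rightarrow> complex" where
  "perf_match H = (\<Sum>F\<in>perfect_matchings H. \<Prod>e\<in>F. weight H e)"

definition standard_signature :: "'v gate \<Rightarrow> complex Matrix.vec" where
  "standard_signature H = (let m = length (outs H) in
     Matrix.vec (2 ^ m)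
       (\<lambda>i. perf_match (del_verts H {outs H ! s | s. s < m \<and> lex_word 2 m i ! s = 1})))"

definition realized_by :: "nat \<Rightarrow> complex Matrix.vec \<Rightarrow> complex mat \<Rightarrow> 'v gate \<Rightarrow> bool" where
  "realized_by n G M H \<longleftrightarrow>
     generator_matchgate H \<and> tensor_power M n *\<^sub>v G = standard_signature H"

end

theory Submission
  imports Defs
begin

text \<open>
  Group the output nodes of a matchgate into \<open>n\<close> blocks of \<open>l\<close>. The unfolding of the standard signature
  at block \<open>t\<close>, with rows indexed by subsets of the block, would factor through \<open>\<complex>\<^sup>3\<close> and
  have rank exactly 3, since \<open>M\<close> and the unfolding of \<open>G\<close> at \<open>t\<close> have rank 3. Signature entries vanish
  unless the number of removed outputs has a fixed parity, so this matrix splits into an even and an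
  odd part whose ranks add up to 3: one of them has rank at least 2 and the other at most 1.
  The matchgate identities forbid this, because they make all \<open>2 \<times> 2\<close> minors of one part
  vanish as soon as those of the other part vanish. The identities themselves come from superposing two
  perfect matchings: the alternating paths joining output nodes cannot cross in the disc.
\<close>


section \<open>Superposed matchings\<close>

text \<open>The number 3 is excluded by an all-or-nothing effect: if both parities have rank at most
  1 the total is at most 2, and if neither has, it is at least 4. One parity controls the other
  because flipping a single output of the block changes the parity of a row. An identity written for
  two rows of one parity therefore relates products of rows of the other; subtracting the same
  identity with the two columns interchanged turns products into minors. Blocks consist of
  consecutive outputs, and this settles the sign when two rows differ in two places. The rank does
  not drop below 3 because a tensor power of an injective \<open>M\<close> is again injective on the
  remaining positions. The topological obstacle is that the graph is not a disc and its outer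
  boundary need not be a closed curve. Alternating paths are therefore prolonged by the dangling
  arcs that define the counterclockwise order, until they end on a circle. Non-crossing then
  concerns four points on a circle, and a map to the half plane reduces it to the Fashoda theorem on
  paths in a box.\<close>

lemma sum_eq_0_of_sign_reversing_involution:
  fixes w :: "'a \<Rightarrow> complex"
  assumes "\<And>x. x \<in> A \<Longrightarrow> h x \<in> A" and "\<And>x. x \<in> A \<Longrightarrow> h (h x) = x"
    and "\<And>x. x \<in> A \<Longrightarrow> w (h x) = - w x"
  shows "sum w A = 0"
proof -
  have "sum w A = sum (\<lambda>x. w (h x)) A"
    by (rule sum.reindex_bij_witness[of _ h h]) (use assms in auto)
  also have "\<dots> = - sum w A"
    by (simp add: assms(3) sum_negf)
  finally show ?thesis by simp
qed

lemma even_card_of_fixpoint_free_involution: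
  fixes A :: "nat set"
  assumes "finite A" and "\<And>x. x \<in> A \<Longrightarrow> h x \<in> A" and "\<And>x. x \<in> A \<Longrightarrow> h (h x) = x"
    and "\<And>x. x \<in> A \<Longrightarrow> h x \<noteq> x"
  shows "even (card A)"
proof -
  let ?L = "{x \<in> A. x < h x}" and ?U = "{x \<in> A. h x < x}"
  have "bij_betw h ?L ?U"
    by (rule bij_betw_byWitness[where f' = h]) (use assms in auto)
  then have "card ?L = card ?U" by (rule bij_betw_same_card)
  moreover have "card A = card ?L + card ?U"
  proof -
    have "A = ?L \<union> ?U" using assms(4) by (auto simp: neq_iff)
    moreover have "card (?L \<union> ?U) = card ?L + card ?U"
      using assms(1) by (intro card_Un_disjoint) auto
    ultimately show ?thesis by simp
  qed
  ultimately show ?thesis by simp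
qed

definition matching :: "'v set set \<Rightarrow> bool" where
  "matching F \<longleftrightarrow> (\<forall>e\<in>F. card e = 2) \<and> (\<forall>e\<in>F. \<forall>e'\<in>F. e \<inter> e' \<noteq> {} \<longrightarrow> e = e')"

definition component :: "'v set set \<Rightarrow> 'v \<Rightarrow> 'v set" where
  "component E v = {(x, y). {x, y} \<in> E}\<^sup>* `` {v}"

lemma component_refl [simp]: "v \<in> component E v"
  by (simp add: component_def)

lemma component_sym: "w \<in> component E v \<Longrightarrow> v \<in> component E w"
proof -
  have "sym ({(x, y). {x, y} \<in> E}\<^sup>*)"
    by (rule sym_rtrancl) (auto simp: sym_def insert_commute)
  then show "w \<in> component E v \<Longrightarrow> v \<in> component E w"
    by (auto simp: component_def dest: symD)
qed

lemma component_eq: "w \<in> component E v \<Longrightarrow> component E w = component E v"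
  using component_sym[of w E v] by (auto simp: component_def intro: rtrancl_trans)

lemma component_disjoint: "w \<notin> component E v \<Longrightarrow> component E w \<inter> component E v = {}"
  by (metis component_eq component_refl disjoint_iff)

lemma component_least:
  assumes "v \<in> X" and "\<And>x y. x \<in> X \<Longrightarrow> {x, y} \<in> E \<Longrightarrow> y \<in> X"
  shows "component E v \<subseteq> X"
proof
  fix y assume "y \<in> component E v"
  then have "(v, y) \<in> {(x, y). {x, y} \<in> E}\<^sup>*" by (simp add: component_def)
  then show "y \<in> X" by (induction rule: rtrancl_induct) (use assms in auto)
qed

lemma component_step: "x \<in> component E v \<Longrightarrow> {x, y} \<in> E \<Longrightarrow> y \<in> component E v"
  by (auto simp: component_def intro: rtrancl_into_rtrancl)

lemma component_edge:
  assumes "x \<in> component E v" and "x \<in> e" and "e \<in> E" and "card e = 2"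
  shows "e \<subseteq> component E v"
proof -
  obtain a b where "e = {a, b}" using assms(4) by (auto simp: card_2_iff)
  then show ?thesis using assms component_step[of x E v]
    by (auto simp: insert_commute)
qed

lemma matching_Diff: "matching F \<Longrightarrow> matching (F - X)"
  by (auto simp: matching_def)

lemma matching_Union_remove:
  assumes "matching F" and "e \<in> F"
  shows "\<Union>(F - {e}) = \<Union>F - e"
  using assms unfolding matching_def by blast

text \<open>The component of \<open>v\<close> is an alternating path, followed edge by edge: after
  its first edge is deleted, either the path stops at the next vertex, or that vertex is in the same
  situation with the two matchings interchanged.\<close>

lemma superposition_other_end_left:
  assumes "finite F1" "finite F2" "matching F1" "matching F2" "v \<in> \<Union>F1" "v \<notin> \<Union>F2"
  shows "\<exists>q. q \<noteq> v \<and> {x \<in> component (F1 \<union> F2) v. (x \<in> \<Union>F1) \<noteq> (x \<in> \<Union>F2)} = {v, q}"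
  using assms
proof (induction "card F1 + card F2" arbitrary: F1 F2 v rule: less_induct)
  case less
  obtain e where e: "e \<in> F1" "v \<in> e" using less.prems by auto
  have "card e = 2" using less.prems(3) e by (auto simp: matching_def)
  then obtain w where ew: "e = {v, w}" "w \<noteq> v"
    using e(2) by (auto simp: card_2_iff)
  let ?G = "F1 - {e}"
  have UG: "\<Union>?G = \<Union>F1 - {v, w}"
    using matching_Union_remove[OF less.prems(3) e(1)] ew by simp
  have vG: "v \<notin> \<Union>(?G \<union> F2)" using UG less.prems(6) by auto
  have w1: "w \<in> \<Union>F1" using e ew by auto
  \<comment> \<open>\<open>v\<close> lies on no edge but \<open>e\<close>, so its component is
    \<open>v\<close> together with what \<open>w\<close> reaches without \<open>e\<close>.\<close>
  have comp: "component (F1 \<union> F2) v = insert v (component (?G \<union> F2) w)"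
  proof
    show "component (F1 \<union> F2) v \<subseteq> insert v (component (?G \<union> F2) w)"
    proof (rule component_least)
      fix x y assume x: "x \<in> insert v (component (?G \<union> F2) w)" and xy: "{x, y} \<in> F1 \<union> F2"
      show "y \<in> insert v (component (?G \<union> F2) w)"
      proof (cases "{x, y} = e")
        case True
        then have "y = v \<or> y = w" using ew by (auto simp: doubleton_eq_iff)
        then show ?thesis by auto
      next
        case False
        then have xy: "{x, y} \<in> ?G \<union> F2" using xy by auto
        then have "x \<noteq> v" using vG by auto
        then have "x \<in> component (?G \<union> F2) w" using x by auto
        then show ?thesis using component_step[OF _ xy] by blast
      qed
    qed simp
    have vw: "w \<in> component (F1 \<union> F2) v"
      by (rule component_step[of v]) (use e ew in auto)
    have "component (?G \<union> F2) w \<subseteq> component (F1 \<union> F2) v"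
      by (rule component_least) (use vw component_step[of _ "F1 \<union> F2" v] in auto)
    then show "insert v (component (?G \<union> F2) w) \<subseteq> component (F1 \<union> F2) v" by simp
  qed
  have vc: "v \<notin> component (?G \<union> F2) w"
  proof -
    have "component (?G \<union> F2) w \<subseteq> - {v}"
    proof (rule component_least)
      fix x y assume "{x, y} \<in> ?G \<union> F2"
      then have "y \<in> \<Union>(?G \<union> F2)" by auto
      then show "y \<in> - {v}" using vG by auto
    qed (use ew in auto)
    then show ?thesis by auto
  qed
  show ?case
  proof (cases "w \<in> \<Union>F2")
    case False
    have "component (?G \<union> F2) w \<subseteq> {w}"
    proof (rule component_least)
      fix x y assume "x \<in> {w}" "{x, y} \<in> ?G \<union> F2"
      then have "w \<in> \<Union>(?G \<union> F2)" by auto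
      then show "y \<in> {w}" using UG False by auto
    qed simp
    then have "component (F1 \<union> F2) v = {v, w}" using comp by (auto simp: subset_singleton_iff)
    then have "{x \<in> component (F1 \<union> F2) v. (x \<in> \<Union>F1) \<noteq> (x \<in> \<Union>F2)} = {v, w}"
      using False w1 less.prems(5,6) by auto
    then show ?thesis using ew by blast
  next
    case True
    \<comment> \<open>The matchings change roles: with \<open>e\<close> gone, \<open>w\<close> is
      covered by \<open>F2\<close> alone.\<close>
    have "card F2 + card ?G < card F1 + card F2"
      using card_Diff1_less[OF less.prems(1) e(1)] by simp
    then obtain q where q: "q \<noteq> w"
      "{x \<in> component (F2 \<union> ?G) w. (x \<in> \<Union>F2) \<noteq> (x \<in> \<Union>?G)} = {w, q}"
      using less.hyps[of F2 ?G w] less.prems matching_Diff[OF less.prems(3)] True UG by auto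
    then have set: "{x \<in> component (?G \<union> F2) w. (x \<in> \<Union>F2) \<noteq> (x \<in> \<Union>?G)} = {w, q}"
      by (simp add: Un_commute)
    then have "q \<in> component (?G \<union> F2) w" by auto
    then have "q \<noteq> v" using vc by auto
    have "{x \<in> component (F1 \<union> F2) v. (x \<in> \<Union>F1) \<noteq> (x \<in> \<Union>F2)} = {v, q}" (is "?A = _")
    proof (rule Set.set_eqI)
      fix x
      consider "x = v" | "x = w" | "x \<noteq> v" "x \<noteq> w" by auto
      then show "x \<in> ?A \<longleftrightarrow> x \<in> {v, q}"
      proof cases
        case 1 then show ?thesis using less.prems by auto
      next
        \<comment> \<open>\<open>w\<close> is an end of the shortened path, but both matchings cover
          it here, so it drops out.\<close>
        case 2 then show ?thesis using w1 True ew q by auto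
      next
        case 3
        then have "x \<in> ?A \<longleftrightarrow> x \<in> {x \<in> component (?G \<union> F2) w. (x \<in> \<Union>F2) \<noteq> (x \<in> \<Union>?G)}"
          unfolding comp UG by auto
        then show ?thesis unfolding set using 3 by auto
      qed
    qed
    then show ?thesis using \<open>q \<noteq> v\<close> by blast
  qed
qed

lemma superposition_other_end:
  assumes "finite F1" "finite F2" "matching F1" "matching F2" "(v \<in> \<Union>F1) \<noteq> (v \<in> \<Union>F2)"
  shows "\<exists>q. q \<noteq> v \<and> {x \<in> component (F1 \<union> F2) v. (x \<in> \<Union>F1) \<noteq> (x \<in> \<Union>F2)} = {v, q}"
proof (cases "v \<in> \<Union>F1")
  case True
  then show ?thesis using superposition_other_end_left[of F1 F2 v] assms by auto
next
  case False
  have "{x \<in> component (F2 \<union> F1) v. (x \<in> \<Union>F2) \<noteq> (x \<in> \<Union>F1)} =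
    {x \<in> component (F1 \<union> F2) v. (x \<in> \<Union>F1) \<noteq> (x \<in> \<Union>F2)}"
    by (auto simp: Un_commute)
  then show ?thesis using superposition_other_end_left[of F2 F1 v] assms False by auto
qed

text \<open>Passing from \<open>p\<close> to \<open>q\<close> adds \<open>p\<close> itself and the
  elements strictly between, an odd number in all.\<close>

lemma sign_flip_of_even_between:
  fixes D :: "nat set"
  assumes "finite D" "p \<in> D" "q \<in> D" "p < q" "even (card {s \<in> D. p < s \<and> s < q})"
  shows "(-1 :: complex) ^ card {s \<in> D. s < q} = - ((-1) ^ card {s \<in> D. s < p})"
proof -
  have "{s \<in> D. s < q} = {s \<in> D. s < p} \<union> insert p {s \<in> D. p < s \<and> s < q}"
    using assms by auto
  moreover have "card ({s \<in> D. s < p} \<union> insert p {s \<in> D. p < s \<and> s < q}) =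
      card {s \<in> D. s < p} + card (insert p {s \<in> D. p < s \<and> s < q})"
    using assms(1) by (intro card_Un_disjoint) auto
  moreover have "card (insert p {s \<in> D. p < s \<and> s < q}) = Suc (card {s \<in> D. p < s \<and> s < q})"
    using assms(1) by (subst card_insert_disjoint) auto
  ultimately show ?thesis using assms(5) by (simp add: power_add)
qed


section \<open>Paths in a disc\<close>

text \<open>The Cayley transform maps the disc to the upper half plane and \<open>c\<close> to infinity.\<close>

definition cayley :: "complex \<Rightarrow> complex \<Rightarrow> real^2" where
  "cayley c z = (let w = \<i> * (c + z) / (c - z) in vector [Re w, Im w])"

lemma cayley_nth: "cayley c z $ 1 = Re (\<i> * (c + z) / (c - z))" "cayley c z $ 2 = Im (\<i> * (c + z) / (c - z))"
  by (auto simp: cayley_def Let_def)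

text \<open>The numerator shows where points go: the circle around 0 through \<open>c\<close> to the
  axis, the disc inside it to the upper half plane.\<close>

lemma cayley_Im:
  assumes "c \<noteq> z"
  shows "cayley c z $ 2 = ((cmod c)\<^sup>2 - (cmod z)\<^sup>2) / (cmod (c - z))\<^sup>2"
proof -
  have "Im (\<i> * (c + z) / (c - z)) = Re ((c + z) / (c - z))"
    by (metis Im_i_times times_divide_eq_right)
  also have "\<dots> = Re ((c + z) * cnj (c - z)) / (cmod (c - z))\<^sup>2"
    by (simp add: complex_div_cnj[of "c+z" "c-z"] flip: of_real_power)
  also have "Re ((c + z) * cnj (c - z)) = (cmod c)\<^sup>2 - (cmod z)\<^sup>2"
    unfolding cmod_power2 by (simp add: algebra_simps power2_eq_square)
  finally show ?thesis by (simp add: cayley_nth)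
qed

lemma cayley_inj:
  assumes "cayley c z = cayley c w" "c \<noteq> z" "c \<noteq> w" "c \<noteq> 0"
  shows "z = w"
proof -
  have "\<i> * (c + z) / (c - z) = \<i> * (c + w) / (c - w)"
    using assms(1) by (metis cayley_nth complex_eqI)
  then have "(c + z) * (c - w) = (c + w) * (c - z)"
    using assms(2,3) by (simp add: divide_simps mult.commute mult.left_commute)
  then have "2 * c * (z - w) = 0" by (simp add: algebra_simps)
  then show ?thesis using assms(4) by simp
qed

text \<open>Sum and difference of the two points are both multiples of \<open>cis m\<close> at the
  mean angle, which cancels. As \<open>cot\<close> decreases between 0 and \<open>pi\<close>,
  increasing angle becomes left-to-right order on the axis.\<close>

lemma cayley_circle:
  assumes "r > 0" "\<phi> < \<theta>" "\<theta> < \<phi> + 2 * pi"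
  shows "cayley (of_real r * cis \<phi>) (of_real r * cis \<theta>) $ 1 = - cot ((\<theta> - \<phi>) / 2)"
proof -
  define a where "a = (\<theta> - \<phi>) / 2"
  define m where "m = (\<theta> + \<phi>) / 2"
  have t: "\<theta> = m + a" "\<phi> = m - a" by (auto simp: a_def m_def field_simps)
  have a: "0 < a" "a < pi" using assms by (auto simp: a_def)
  have s: "sin a > 0" using a by (rule sin_gt_zero)
  have 1: "of_real r * cis \<phi> + of_real r * cis \<theta> = of_real (2 * r * cos a) * cis m"
    unfolding t by (simp add: complex_eq_iff cos_add cos_diff sin_add sin_diff algebra_simps)
  have 2: "of_real r * cis \<phi> - of_real r * cis \<theta> = - \<i> * of_real (2 * r * sin a) * cis m"
    unfolding t by (simp add: complex_eq_iff cos_add cos_diff sin_add sin_diff algebra_simps)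
  have "\<i> * (of_real r * cis \<phi> + of_real r * cis \<theta>) / (of_real r * cis \<phi> - of_real r * cis \<theta>)
      = - of_real (cos a / sin a)"
    unfolding 1 2 using s assms(1) by (simp add: field_simps)
  then have "cayley (of_real r * cis \<phi>) (of_real r * cis \<theta>) $ 1 = - (cos a / sin a)"
    unfolding cayley_nth by simp
  then show ?thesis by (simp add: a_def cot_def)
qed

lemma cot_strict_antimono:
  assumes "0 < x" "x < y" "y < pi"
  shows "cot y < cot (x::real)"
proof -
  have s: "sin x > 0" "sin y > 0" "sin (y - x) > 0"
    using assms by (auto intro: sin_gt_zero)
  have "cot x - cot y = sin (y - x) / (sin x * sin y)"
    using s by (simp add: cot_def sin_diff field_simps)
  then show ?thesis using s by (metis diff_gt_0_iff_gt divide_pos_pos mult_pos_pos)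
qed

text \<open>After the Cayley transform both images lie in a box whose bottom side contains the four
  ends, starts and finishes alternating from left to right; such paths meet by the Fashoda
  theorem.\<close>

lemma disc_paths_interlace:
  fixes f g :: "real \<Rightarrow> complex"
  assumes r: "r > 0" and f: "path f" and g: "path g"
    and fi: "path_image f - {pathstart f, pathfinish f} \<subseteq> ball 0 r"
    and gi: "path_image g - {pathstart g, pathfinish g} \<subseteq> ball 0 r"
    and ends: "pathstart f = of_real r * cis \<theta>1" "pathstart g = of_real r * cis \<theta>2"
      "pathfinish f = of_real r * cis \<theta>3" "pathfinish g = of_real r * cis \<theta>4"
    and ang: "\<theta>1 < \<theta>2" "\<theta>2 < \<theta>3" "\<theta>3 < \<theta>4" "\<theta>4 < \<theta>1 + 2 * pi"
  shows "path_image f \<inter> path_image g \<noteq> {}"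
proof -
  \<comment> \<open>The middle of the gap between the last angle, taken one turn earlier, and the
    first one.\<close>
  define \<phi> where "\<phi> = (\<theta>4 - 2 * pi + \<theta>1) / 2"
  have \<phi>: "\<phi> < \<theta>1" "\<theta>4 < \<phi> + 2 * pi" using ang by (auto simp: \<phi>_def field_simps)
  define c where "c = of_real r * cis \<phi>"
  have c0: "c \<noteq> 0" "cmod c = r" using r by (auto simp: c_def norm_mult)
  let ?h = "cayley c"
  have cne: "c \<noteq> of_real r * cis \<theta>" if "\<phi> < \<theta>" "\<theta> < \<phi> + 2 * pi" for \<theta>
  proof
    assume "c = of_real r * cis \<theta>"
    then have "cis \<phi> = cis \<theta>" using r by (simp add: c_def)
    then have "cis (\<theta> - \<phi>) = 1" by (simp add: cis_divide[symmetric])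
    then have "cos (\<theta> - \<phi>) = 1" by (metis cis.sel(1) one_complex.sel(1))
    moreover have "cos (\<theta> - \<phi>) < 1"
    proof -
      have "sin ((\<theta> - \<phi>) / 2) > 0" using that by (intro sin_gt_zero) auto
      then have "sin ((\<theta> - \<phi>) / 2) ^ 2 > 0" by simp
      moreover have "cos (\<theta> - \<phi>) = 1 - 2 * sin ((\<theta> - \<phi>) / 2) ^ 2"
        using cos_double_sin[of "(\<theta> - \<phi>) / 2"] by (simp only: field_sum_of_halves mult_2)
      ultimately show ?thesis by simp
    qed
    ultimately show False by simp
  qed
  \<comment> \<open>The paths touch the circle only at their ends, so neither runs through the pole
    \<open>c\<close>.\<close>
  have mem: "cmod z \<le> r \<and> z \<noteq> c" if "z \<in> path_image f \<union> path_image g" for z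
  proof (cases "z \<in> ball 0 r")
    case True then show ?thesis using c0 by auto
  next
    case False
    then have "\<exists>\<theta>\<in>{\<theta>1,\<theta>2,\<theta>3,\<theta>4}. z = of_real r * cis \<theta>"
      using that fi gi ends by auto
    then obtain \<theta> where "\<theta> \<in> {\<theta>1,\<theta>2,\<theta>3,\<theta>4}" "z = of_real r * cis \<theta>" by blast
    moreover then have "\<phi> < \<theta>" "\<theta> < \<phi> + 2 * pi" using ang \<phi> by auto
    ultimately show ?thesis using cne[of \<theta>] r by (auto simp: norm_mult)
  qed
  have cont: "continuous_on (path_image f \<union> path_image g) ?h"
  proof -
    have *: "?h = (\<lambda>z. \<chi> i. if i = 1 then Re (\<i> * (c + z) / (c - z)) else Im (\<i> * (c + z) / (c - z)))"
      by (auto simp: fun_eq_iff Finite_Cartesian_Product.vec_eq_iff forall_2 cayley_nth)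
    have c: "c \<notin> path_image f" "c \<notin> path_image g" using mem by blast+
    show ?thesis unfolding *
    proof (rule continuous_on_vec_lambda)
      fix i :: 2
      show "continuous_on (path_image f \<union> path_image g)
        (\<lambda>z. if i = 1 then Re (\<i> * (c + z) / (c - z)) else Im (\<i> * (c + z) / (c - z)))"
        using c by (cases "i = 1") (auto intro!: continuous_intros)
    qed
  qed
  let ?f = "?h \<circ> f" and ?g = "?h \<circ> g"
  have pf: "path ?f" "path ?g"
    using f g cont by (auto intro!: path_continuous_image intro: continuous_on_subset)
  let ?I = "path_image ?f \<union> path_image ?g"
  have "bounded ?I" using pf by (auto intro: bounded_path_image)
  then obtain B where B: "\<And>x. x \<in> ?I \<Longrightarrow> norm x \<le> B" by (auto simp: bounded_iff)
  \<comment> \<open>The bottom side is at height 0 because the ends must lie on it; the other sides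
    only have to be far enough out.\<close>
  define a where "a = (vector [- B, 0] :: real^2)"
  define b where "b = (vector [B, B] :: real^2)"
  have "?I \<subseteq> cbox a b"
  proof
    fix x assume x: "x \<in> ?I"
    then obtain z where z: "z \<in> path_image f \<union> path_image g" "x = ?h z"
      by (auto simp: path_image_compose)
    have "0 \<le> x $ 2"
      unfolding z(2) using mem[OF z(1)] c0 by (subst cayley_Im) (auto intro!: divide_nonneg_nonneg power_mono)
    moreover have "\<bar>x $ 1\<bar> \<le> B" "\<bar>x $ 2\<bar> \<le> B"
      using B[OF x] component_le_norm_cart[of x] order_trans by blast+
    ultimately show "x \<in> cbox a b"
      by (auto simp: mem_box_cart forall_2 a_def b_def)
  qed
  then have sub: "path_image ?f \<subseteq> cbox a b" "path_image ?g \<subseteq> cbox a b" by auto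
  have b0: "?h (of_real r * cis \<theta>) $ 2 = a $ 2" if "\<phi> < \<theta>" "\<theta> < \<phi> + 2 * pi" for \<theta>
    using cne[OF that] c0 r by (subst cayley_Im) (auto simp: a_def norm_mult)
  have lt: "?h (of_real r * cis x) $ 1 < ?h (of_real r * cis y) $ 1"
    if "\<phi> < x" "x < y" "y < \<phi> + 2 * pi" for x y
    unfolding c_def using that r cot_strict_antimono[of "(x-\<phi>)/2" "(y-\<phi>)/2"]
    by (subst (1 2) cayley_circle) auto
  obtain z where "z \<in> path_image ?f" "z \<in> path_image ?g"
    by (rule fashoda_interlace[of ?f ?g a b])
      (use pf sub ang \<phi> in \<open>auto simp: pathstart_compose pathfinish_compose ends intro!: b0 lt\<close>)
  then obtain u v where uv: "u \<in> path_image f" "v \<in> path_image g" "?h u = ?h v"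
    by (auto simp: path_image_compose)
  then have "u = v" using mem[of u] mem[of v] c0 by (intro cayley_inj[of c]) auto
  then show ?thesis using uv by auto
qed


section \<open>Exchanging two matchings inside a set of vertices\<close>

definition swap_on :: "'v set \<Rightarrow> 'v set set \<Rightarrow> 'v set set \<Rightarrow> 'v set set" where
  "swap_on C F1 F2 = {e \<in> F1. \<not> e \<subseteq> C} \<union> {e \<in> F2. e \<subseteq> C}"

lemma swap_on_Un: "swap_on C F1 F2 \<union> swap_on C F2 F1 = F1 \<union> F2"
  by (auto simp: swap_on_def)

text \<open>The test \<open>e \<subseteq> C\<close> depends on the edge alone, so a second exchange
  returns each edge to its matching.\<close>

lemma swap_on_swap_on: "swap_on C (swap_on C F1 F2) (swap_on C F2 F1) = F1"
  by (auto simp: swap_on_def)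

lemma prod_swap_on:
  fixes w :: "'v set \<Rightarrow> complex"
  assumes "finite F1" "finite F2"
  shows "prod w (swap_on C F1 F2) * prod w (swap_on C F2 F1) = prod w F1 * prod w F2"
proof -
  have split: "prod w (swap_on C A B) = prod w {e \<in> A. \<not> e \<subseteq> C} * prod w {e \<in> B. e \<subseteq> C}"
    if "finite A" "finite B" for A B
    unfolding swap_on_def using that by (intro prod.union_disjoint) auto
  have whole: "prod w A = prod w {e \<in> A. \<not> e \<subseteq> C} * prod w {e \<in> A. e \<subseteq> C}" if "finite A" for A
    using split[OF that that] that
    by (metis (no_types, lifting) Un_absorb swap_on_Un swap_on_swap_on swap_on_def)
  show ?thesis
    using split[OF assms] split[OF assms(2,1)] whole[OF assms(1)] whole[OF assms(2)]
    by (simp add: mult_ac)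
qed

text \<open>\<open>C\<close> will be a component of \<open>F1 \<union> F2\<close>; its closure under
  edges keeps an edge taken inside \<open>C\<close> from meeting one taken outside.\<close>

lemma matching_swap_on:
  assumes "matching F1" "matching F2" and "\<And>e. e \<in> F1 \<union> F2 \<Longrightarrow> e \<inter> C \<noteq> {} \<Longrightarrow> e \<subseteq> C"
  shows "matching (swap_on C F1 F2)"
  unfolding matching_def
proof (intro conjI ballI impI)
  fix e assume "e \<in> swap_on C F1 F2"
  then show "card e = 2" using assms(1,2) by (auto simp: swap_on_def matching_def)
next
  fix e e' assume e: "e \<in> swap_on C F1 F2" "e' \<in> swap_on C F1 F2" and i: "e \<inter> e' \<noteq> {}"
  have "e \<subseteq> C \<longleftrightarrow> e' \<subseteq> C"
    using assms(3)[of e] assms(3)[of e'] e i unfolding swap_on_def by blast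
  then consider "e \<in> F1" "e' \<in> F1" | "e \<in> F2" "e' \<in> F2"
    using e unfolding swap_on_def by blast
  then show "e = e'" using i assms(1,2) unfolding matching_def by cases blast+
qed

lemma Union_swap_on:
  assumes "matching F1" "matching F2" and "\<And>e. e \<in> F1 \<union> F2 \<Longrightarrow> e \<inter> C \<noteq> {} \<Longrightarrow> e \<subseteq> C"
  shows "\<Union>(swap_on C F1 F2) = (\<Union>F1 - C) \<union> (\<Union>F2 \<inter> C)"
  using assms(3) unfolding swap_on_def by blast

text \<open>A prescribed union replaces the condition on single vertices, so that the effect of an
  exchange becomes set algebra.\<close>

lemma perfect_matchings_del_verts:
  assumes "wf_gate H"
  shows "perfect_matchings (del_verts H Z) = {F. F \<subseteq> edges H \<and> matching F \<and> \<Union>F = verts H - Z}"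
proof (intro subset_antisym subsetI)
  fix F assume "F \<in> perfect_matchings (del_verts H Z)"
  then have F: "F \<subseteq> {e \<in> edges H. e \<inter> Z = {}}" "\<And>v. v \<in> verts H - Z \<Longrightarrow> \<exists>!e. e \<in> F \<and> v \<in> e"
    by (auto simp: perfect_matchings_def del_verts_def)
  have sub: "\<Union>F \<subseteq> verts H - Z" using F(1) assms unfolding wf_gate_def by blast
  have "matching F"
    unfolding matching_def
  proof (intro conjI ballI impI)
    fix e assume "e \<in> F" then show "card e = 2" using F(1) assms by (auto simp: wf_gate_def)
  next
    fix e e' assume e: "e \<in> F" "e' \<in> F" "e \<inter> e' \<noteq> {}"
    then obtain v where v: "v \<in> e" "v \<in> e'" by auto
    then have "v \<in> verts H - Z" using sub e by auto
    then show "e = e'" using F(2)[of v] e v by auto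
  qed
  moreover have "verts H - Z \<subseteq> \<Union>F" using F(2) by blast
  ultimately show "F \<in> {F. F \<subseteq> edges H \<and> matching F \<and> \<Union>F = verts H - Z}"
    using F(1) sub by auto
next
  fix F assume "F \<in> {F. F \<subseteq> edges H \<and> matching F \<and> \<Union>F = verts H - Z}"
  then have F: "F \<subseteq> edges H" "matching F" "\<Union>F = verts H - Z" by auto
  have "\<exists>!e. e \<in> F \<and> v \<in> e" if v: "v \<in> verts H - Z" for v
  proof -
    obtain e where e: "e \<in> F" "v \<in> e" using v F(3) by blast
    have "e' = e" if "e' \<in> F" "v \<in> e'" for e'
      using F(2) e that unfolding matching_def by (meson disjoint_iff)
    then show ?thesis using e by auto
  qed
  moreover have "F \<subseteq> {e \<in> edges H. e \<inter> Z = {}}" using F(1,3) by blast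
  ultimately show "F \<in> perfect_matchings (del_verts H Z)"
    by (auto simp: perfect_matchings_def del_verts_def)
qed

section \<open>Components of a subgraph in the plane drawing\<close>

lemma component_path:
  assumes "\<And>e. e \<in> E \<Longrightarrow> path (\<gamma> e) \<and> p ` e \<subseteq> path_image (\<gamma> e) \<and> card e = 2"
    and "x \<in> component E v"
  shows "path_component (insert (p v) (\<Union>e\<in>{e \<in> E. e \<subseteq> component E v}. path_image (\<gamma> e))) (p v) (p x)"
    (is "path_component ?K _ _")
proof -
  have "component E v \<subseteq> {x \<in> component E v. path_component ?K (p v) (p x)}"
  proof (rule component_least)
    show "v \<in> {x \<in> component E v. path_component ?K (p v) (p x)}"
      by (simp add: path_component_refl)
  next
    fix x y assume x: "x \<in> {x \<in> component E v. path_component ?K (p v) (p x)}" and xy: "{x, y} \<in> E"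
    have e: "{x, y} \<subseteq> component E v" using x component_step[OF _ xy] by auto
    have "path_component (path_image (\<gamma> {x, y})) (p x) (p y)"
      using assms(1)[OF xy] path_connected_path_image[of "\<gamma> {x, y}"]
      by (auto simp: path_connected_component)
    then have "path_component ?K (p x) (p y)"
      by (rule path_component_of_subset[rotated]) (use e xy in blast)
    then show "y \<in> {x \<in> component E v. path_component ?K (p v) (p x)}"
      using x e path_component_trans by blast
  qed
  then show ?thesis using assms(2) by auto
qed

text \<open>Disjoint components have disjoint drawings. Prolonged by the dangling arcs of their
  outputs, they would contain two paths in the disc that have interlaced ends and yet do not
  meet.\<close>

lemma components_noncrossing:
  assumes H: "generator_matchgate H" and E: "E \<subseteq> edges H"
    and ij: "i < j" "j < k" "k < l" "l < length (outs H)"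
    and ik: "outs H ! k \<in> component E (outs H ! i)"
    and jl: "outs H ! l \<in> component E (outs H ! j)"
  shows "outs H ! j \<in> component E (outs H ! i)"
proof (rule ccontr)
  assume "outs H ! j \<notin> component E (outs H ! i)"
  then have dis: "component E (outs H ! j) \<inter> component E (outs H ! i) = {}"
    by (rule component_disjoint)
  have wf: "wf_gate H" using H by (simp add: generator_matchgate_def)
  obtain p \<gamma> where pe: "plane_embedding H p \<gamma>" and oc: "outs_counterclockwise H p \<gamma>"
    using H unfolding generator_matchgate_def by blast
  obtain r \<alpha> \<theta> where
    ball: "drawing H p \<gamma> \<subseteq> ball 0 r" and
    a: "\<And>i. i < length (outs H) \<Longrightarrow> arc (\<alpha> i) \<and> pathstart (\<alpha> i) = p (outs H ! i) \<and>
           pathfinish (\<alpha> i) = of_real r * cis (\<theta> i) \<and>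
           path_image (\<alpha> i) - {pathstart (\<alpha> i)} \<subseteq> outer_face H p \<gamma> \<and>
           path_image (\<alpha> i) - {pathfinish (\<alpha> i)} \<subseteq> ball 0 r" and
    adis: "\<And>i j. i < length (outs H) \<Longrightarrow> j < length (outs H) \<Longrightarrow> i \<noteq> j \<Longrightarrow>
        path_image (\<alpha> i) \<inter> path_image (\<alpha> j) = {}" and
    ang: "\<And>i j. i < length (outs H) \<Longrightarrow> j < length (outs H) \<Longrightarrow> i < j \<Longrightarrow>
        \<theta> i < \<theta> j \<and> \<theta> j < \<theta> i + 2 * pi"
    using oc unfolding outs_counterclockwise_def by metis
  let ?o = "(!) (outs H)"
  have lt: "i < length (outs H)" "j < length (outs H)" "k < length (outs H)" using ij by auto
  have ov: "?o s \<in> verts H" if "s < length (outs H)" for s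
    using wf that unfolding wf_gate_def by (meson nth_mem subsetD)
  have arcs: "path (\<gamma> e) \<and> p ` e \<subseteq> path_image (\<gamma> e) \<and> card e = 2 \<and> e \<subseteq> verts H \<and>
      path_image (\<gamma> e) \<inter> p ` verts H = p ` e" if "e \<in> E" for e
  proof -
    have "e \<in> edges H" using that E by auto
    then have e: "arc (\<gamma> e)" "path_image (\<gamma> e) \<inter> p ` verts H = p ` e" "e \<subseteq> verts H" "card e = 2"
      using pe wf by (simp_all add: plane_embedding_def wf_gate_def)
    then have "p ` e \<subseteq> path_image (\<gamma> e)" by blast
    then show ?thesis using e by (simp add: arc_imp_path)
  qed
  \<comment> \<open>The drawing of the component of output \<open>s\<close>; its point is inserted
    for the case that no edge of \<open>E\<close> meets it.\<close>
  define K where "K = (\<lambda>s. insert (p (?o s)) (\<Union>e\<in>{e \<in> E. e \<subseteq> component E (?o s)}. path_image (\<gamma> e)))"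
  \<comment> \<open>The dangling arcs of both outputs are attached, so that the set reaches the
    circle at both ends.\<close>
  define L where "L = (\<lambda>s t. path_image (\<alpha> s) \<union> K s \<union> path_image (\<alpha> t))"
  have Kdr: "K s \<subseteq> drawing H p \<gamma>" if "s < length (outs H)" for s
    using ov[OF that] E unfolding K_def drawing_def by auto
  have inj: "inj_on p (verts H)" using pe by (simp add: plane_embedding_def)
  \<comment> \<open>An arc meets vertex points only at the ends of its edge and \<open>p\<close> is
    injective, so an output drawn on \<open>K s\<close> belongs to the component of output
    \<open>s\<close>.\<close>
  have pK: "s = t" if "p (?o t) \<in> K s" "?o t \<notin> component E (?o s)"
      "s < length (outs H)" "t < length (outs H)" for s t
  proof (rule ccontr)
    assume "s \<noteq> t"
    from that(1) consider "p (?o t) = p (?o s)" |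
        e where "e \<in> E" "e \<subseteq> component E (?o s)" "p (?o t) \<in> path_image (\<gamma> e)"
      unfolding K_def by auto
    then show False
    proof cases
      case 1
      then have "?o t = ?o s" using inj ov that(3,4) by (auto dest: inj_onD)
      then show ?thesis using that(2) by simp
    next
      case 2
      then have "p (?o t) \<in> p ` e" using arcs[of e] ov[OF that(4)] by blast
      then have "?o t \<in> e" using inj ov[OF that(4)] arcs[OF 2(1)] by (simp add: inj_on_image_mem_iff)
      then show ?thesis using 2(2) that(2) by auto
    qed
  qed
  have Kdis: "K i \<inter> K j = {}"
  proof (rule ccontr)
    assume "K i \<inter> K j \<noteq> {}"
    then obtain z where z: "z \<in> K i" "z \<in> K j" by auto
    have jn: "?o j \<notin> component E (?o i)" "?o i \<notin> component E (?o j)"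
      using dis component_refl[of "?o j" E] component_refl[of "?o i" E] by blast+
    have "z \<noteq> p (?o i)" "z \<noteq> p (?o j)"
      using pK[where s = i and t = j] pK[where s = j and t = i] z jn ij lt by auto
    then obtain e f where ef: "e \<in> E" "e \<subseteq> component E (?o i)" "z \<in> path_image (\<gamma> e)"
       "f \<in> E" "f \<subseteq> component E (?o j)" "z \<in> path_image (\<gamma> f)"
      using z unfolding K_def by auto
    have "e \<inter> f = {}" using ef dis by auto
    moreover have "e \<noteq> {}" using arcs[OF ef(1)] by auto
    ultimately have "e \<noteq> f" by auto
    then have "path_image (\<gamma> e) \<inter> path_image (\<gamma> f) \<subseteq> p ` (e \<inter> f)"
      using pe subsetD[OF E ef(1)] subsetD[OF E ef(4)] by (simp add: plane_embedding_def)
    then show False using ef \<open>e \<inter> f = {}\<close> by auto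
  qed
  have out: "outer_face H p \<gamma> \<inter> drawing H p \<gamma> = {}"
    unfolding outer_face_def by (metis Int_commute outside_no_overlap)
  \<comment> \<open>Apart from its start, a dangling arc runs in the outer face, which is disjoint
    from the drawing.\<close>
  have aK: "path_image (\<alpha> s) \<inter> K t = {}" if "s < length (outs H)" "t < length (outs H)"
    "p (?o s) \<notin> K t" for s t
    using a[OF that(1)] Kdr[OF that(2)] out that(3) by fastforce
  have pin: "p (?o i) \<in> K i" "p (?o j) \<in> K j" by (auto simp: K_def)
  have pc: "path_component (K s) (p (?o s)) (p (?o t))" if "?o t \<in> component E (?o s)" for s t
    unfolding K_def by (rule component_path) (use arcs that in auto)
  have Lpath: "\<exists>f. path f \<and> path_image f \<subseteq> L s t \<and> pathstart f = of_real r * cis (\<theta> s) \<and>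
      pathfinish f = of_real r * cis (\<theta> t)"
    if st: "s < length (outs H)" "t < length (outs H)" "?o t \<in> component E (?o s)" for s t
  proof -
    have al: "path_component (L s t) (p (?o u)) (of_real r * cis (\<theta> u))" if "u = s \<or> u = t" for u
    proof -
      have "path (\<alpha> u)" "path_image (\<alpha> u) \<subseteq> L s t" "pathstart (\<alpha> u) = p (?o u)"
        "pathfinish (\<alpha> u) = of_real r * cis (\<theta> u)"
        using a[of u] st that by (auto simp: L_def arc_imp_path)
      then show ?thesis unfolding path_component_def by blast
    qed
    have "path_component (L s t) (p (?o s)) (p (?o t))"
      by (rule path_component_of_subset[OF _ pc[OF st(3)]]) (auto simp: L_def)
    then have "path_component (L s t) (of_real r * cis (\<theta> s)) (of_real r * cis (\<theta> t))"
      using al[of s] al[of t] by (meson path_component_sym path_component_trans)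
    then show ?thesis unfolding path_component_def by blast
  qed
  obtain f where f: "path f" "path_image f \<subseteq> L i k" "pathstart f = of_real r * cis (\<theta> i)"
      "pathfinish f = of_real r * cis (\<theta> k)"
    using Lpath[of i k] lt ik by auto
  obtain g where g: "path g" "path_image g \<subseteq> L j l" "pathstart g = of_real r * cis (\<theta> j)"
      "pathfinish g = of_real r * cis (\<theta> l)"
    using Lpath[of j l] lt ij jl by auto
  have Lball: "L s t - {of_real r * cis (\<theta> s), of_real r * cis (\<theta> t)} \<subseteq> ball 0 r"
    if "s < length (outs H)" "t < length (outs H)" for s t
    using a[OF that(1)] a[OF that(2)] Kdr[OF that(1)] ball unfolding L_def by fastforce
  have "p (?o i) \<in> drawing H p \<gamma>" using ov[OF lt(1)] by (auto simp: drawing_def)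
  then have r0: "r > 0" using ball by (metis (full_types) ball_eq_empty empty_iff not_le subsetD)
  have "path_image f \<inter> path_image g \<noteq> {}"
    by (rule disc_paths_interlace[OF r0 f(1) g(1) _ _ f(3) g(3) f(4) g(4)])
      (use f g Lball[of i k] Lball[of j l] lt ij ang[of i j] ang[of j k] ang[of k l] ang[of i l] in auto)
  moreover have "L i k \<inter> L j l = {}"
  proof -
    have pcK: "p (?o i) \<notin> K j" "p (?o j) \<notin> K i" using pin Kdis by auto
    have kn: "?o k \<notin> component E (?o j)" "?o l \<notin> component E (?o i)" using dis ik jl by auto
    have pk: "p (?o k) \<notin> K j" "p (?o l) \<notin> K i"
      using pK[where s = j and t = k] pK[where s = i and t = l] kn ij lt by auto
    show ?thesis
      using aK[where s = i and t = j] aK[where s = k and t = j] aK[where s = j and t = i] aK[where s = l and t = i] pcK pk Kdis lt ij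
        adis[of i j] adis[of i l] adis[of k j] adis[of k l]
      unfolding L_def by auto
  qed
  ultimately show False using f(2) g(2) by blast
qed


section \<open>Matchgate identities\<close>

text \<open>The entry of the standard signature in which the outputs at the positions
  \<open>X\<close> are removed. With sets in place of words, flipping an index is a symmetric
  difference.\<close>

definition signature :: "'v gate \<Rightarrow> nat set \<Rightarrow> complex" where
  "signature H X = perf_match (del_verts H ((!) (outs H) ` X))"

text \<open>In use, \<open>E\<close> is the superposition of two matchings and \<open>D\<close> the
  positions of the outputs covered by exactly one of them; \<open>pairs\<close> then comes from
  \<open>superposition_other_end\<close>.\<close>

locale paired_outputs =
  fixes H :: "'v gate" and E :: "'v set set" and D :: "nat set"
  assumes gate: "generator_matchgate H" and E: "E \<subseteq> edges H" and D: "D \<subseteq> {..<length (outs H)}"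
    and pairs: "\<And>s. s \<in> D \<Longrightarrow> \<exists>q. q \<noteq> s \<and> {t \<in> D. outs H ! t \<in> component E (outs H ! s)} = {s, q}"
begin

definition partner :: "nat \<Rightarrow> nat" where
  "partner s = (THE q. q \<noteq> s \<and> {t \<in> D. outs H ! t \<in> component E (outs H ! s)} = {s, q})"

lemma partner:
  assumes "s \<in> D"
  shows "partner s \<noteq> s" "{t \<in> D. outs H ! t \<in> component E (outs H ! s)} = {s, partner s}"
proof -
  have "\<exists>!q. q \<noteq> s \<and> {t \<in> D. outs H ! t \<in> component E (outs H ! s)} = {s, q}"
    using pairs[OF assms] by (auto simp: doubleton_eq_iff)
  from theI'[OF this] show "partner s \<noteq> s" "{t \<in> D. outs H ! t \<in> component E (outs H ! s)} = {s, partner s}"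
    unfolding partner_def by auto
qed

lemma partner_in: "s \<in> D \<Longrightarrow> partner s \<in> D"
  using partner(2)[of s] by auto

lemma partner_component: "s \<in> D \<Longrightarrow> outs H ! partner s \<in> component E (outs H ! s)"
  using partner(2)[of s] by auto

lemma partner_eqI:
  "s \<in> D \<Longrightarrow> t \<in> D \<Longrightarrow> t \<noteq> s \<Longrightarrow> outs H ! t \<in> component E (outs H ! s) \<Longrightarrow> partner s = t"
  using partner(2)[of s] by auto

lemma partner_partner: "s \<in> D \<Longrightarrow> partner (partner s) = s"
  using partner_eqI[of "partner s" s] partner_in[of s] partner(1)[of s] partner_component[of s]
    component_sym[of "outs H ! partner s" E "outs H ! s"] by auto

text \<open>By non-crossing, the partner of a position between \<open>p\<close> and
  \<open>partner p\<close> lies between them too, so these positions are paired off among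
  themselves.\<close>

lemma even_between:
  assumes p: "p \<in> D" and less: "p < partner p"
  shows "even (card {s \<in> D. p < s \<and> s < partner p})"
proof (rule even_card_of_fixpoint_free_involution[where h = partner])
  show "finite {s \<in> D. p < s \<and> s < partner p}" by (rule finite_subset[of _ "{..<partner p}"]) auto
next
  fix s assume s: "s \<in> {s \<in> D. p < s \<and> s < partner p}"
  then have sD: "s \<in> D" by auto
  show "partner (partner s) = s" "partner s \<noteq> s" using partner_partner partner sD by auto
  have len: "partner s < length (outs H)" "partner p < length (outs H)"
    using D partner_in sD p by auto
  have nc: "outs H ! s \<notin> component E (outs H ! p)"
    using partner_eqI[OF p sD] s by auto
  have "partner s \<noteq> p" "partner s \<noteq> partner p"
    using partner_partner[OF sD] partner_partner[OF p] s by auto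
  moreover have "\<not> partner s < p"
  proof
    assume "partner s < p"
    have "outs H ! p \<in> component E (outs H ! partner s)"
      by (rule components_noncrossing[OF gate E \<open>partner s < p\<close> _ _ len(2)])
        (use s partner_component[OF p] component_sym[OF partner_component[OF sD]] in auto)
    then have "outs H ! p \<in> component E (outs H ! s)"
      using component_eq[OF partner_component[OF sD]] by simp
    then show False using nc component_sym by metis
  qed
  moreover have "\<not> partner p < partner s"
  proof
    assume *: "partner p < partner s"
    have "outs H ! s \<in> component E (outs H ! p)"
      by (rule components_noncrossing[OF gate E _ _ * len(1)])
        (use s partner_component[OF p] partner_component[OF sD] in auto)
    then show False using nc by simp
  qed
  ultimately show "partner s \<in> {s \<in> D. p < s \<and> s < partner p}"
    using partner_in[OF sD] by auto
qed

lemma partner_sign: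
  assumes p: "p \<in> D"
  shows "(-1 :: complex) ^ card {s \<in> D. s < partner p} = - ((-1) ^ card {s \<in> D. s < p})"
proof -
  have fin: "finite D" using D finite_subset by blast
  consider "p < partner p" | "partner p < p" using partner(1)[OF p] by (auto simp: neq_iff)
  then show ?thesis
  proof cases
    case 1
    then show ?thesis
      using sign_flip_of_even_between[OF fin p partner_in[OF p] 1 even_between[OF p 1]] by simp
  next
    case 2
    have q: "partner p \<in> D" by (rule partner_in[OF p])
    have "even (card {s \<in> D. partner p < s \<and> s < p})"
      using even_between[OF q] 2 by (simp add: partner_partner[OF p])
    then show ?thesis
      using sign_flip_of_even_between[OF fin q p 2] by simp
  qed
qed

end

text \<open>
  Exchanging two matchings along the path of their superposition that starts at output \<open>p\<close> and
  ends at output \<open>q\<close> turns a term for \<open>p\<close> into a term for \<open>q\<close> of the same weight. The paths pair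
  off the outputs in \<open>sym_diff S T\<close> and do not cross, so an even number of them lies between
  \<open>p\<close> and \<open>q\<close>, and the two signs differ.
\<close>

theorem matchgate_identity:
  fixes H :: "'v gate"
  assumes gate: "generator_matchgate H"
    and S: "S \<subseteq> {..<length (outs H)}" and T: "T \<subseteq> {..<length (outs H)}"
  shows "(\<Sum>p\<in>sym_diff S T. (-1) ^ card {s \<in> sym_diff S T. s < p} *
    (signature H (sym_diff S {p}) * signature H (sym_diff T {p}))) = 0"
proof -
  define D where "D = sym_diff S T"
  define m where "m = length (outs H)"
  define z where "z = (!) (outs H)"
  define P where "P = (\<lambda>X. {F. F \<subseteq> edges H \<and> matching F \<and> \<Union>F = verts H - z ` X})"
  have wf: "wf_gate H" using gate by (simp add: generator_matchgate_def)
  have inj: "inj_on z {..<m}"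
    using wf by (auto simp: inj_on_def z_def m_def wf_gate_def nth_eq_iff_index_eq)
  have zv: "z t \<in> verts H" if "t < m" for t
    using wf that unfolding wf_gate_def z_def m_def by (meson nth_mem subsetD)
  have Dm: "D \<subseteq> {..<m}" using S T by (auto simp: D_def m_def)
  have zim: "z t \<in> z ` X \<longleftrightarrow> t \<in> X" if "t < m" "X \<subseteq> {..<m}" for t X
    using inj_on_image_mem_iff[OF inj, of t X] that by auto
  have zmem: "z t \<in> verts H - z ` X \<longleftrightarrow> t \<notin> X" if "t < m" "X \<subseteq> {..<m}" for t X
    using zim[OF that] zv[OF that(1)] by simp
  have finE: "finite (edges H)"
    using wf unfolding wf_gate_def by (meson PowI finite_Pow_iff finite_subset subsetI)
  have finP: "finite (P X)" for X
    by (rule finite_subset[of _ "Pow (edges H)"]) (use finE in \<open>auto simp: P_def\<close>)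
  have sig: "signature H X = (\<Sum>F\<in>P X. prod (weight H) F)" for X
    unfolding signature_def perf_match_def perfect_matchings_del_verts[OF wf] P_def z_def
    by (simp add: del_verts_def)
  have flip: "sym_diff X {p} \<subseteq> {..<m}" if "p \<in> D" "X \<subseteq> {..<m}" for X p
    using that Dm by auto
  have Sm: "S \<subseteq> {..<m}" "T \<subseteq> {..<m}" using S T by (auto simp: m_def)
  let ?\<Omega> = "SIGMA p:D. P (sym_diff S {p}) \<times> P (sym_diff T {p})"
  have pairing: "paired_outputs H (F1 \<union> F2) D"
    if p: "p \<in> D" and F1: "F1 \<in> P (sym_diff S {p})" and F2: "F2 \<in> P (sym_diff T {p})" for p F1 F2
  proof
    show "generator_matchgate H" "D \<subseteq> {..<length (outs H)}" "F1 \<union> F2 \<subseteq> edges H"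
      using gate Dm F1 F2 by (auto simp: m_def P_def)
    fix s assume s: "s \<in> D"
    have fin: "finite F1" "finite F2" "matching F1" "matching F2"
      using F1 F2 finE by (auto simp: P_def intro: finite_subset)
    \<comment> \<open>Flipping \<open>p\<close> in both sets leaves the symmetric difference
      \<open>D\<close> unchanged, so exactly the outputs in \<open>D\<close> are covered by just one
      matching.\<close>
    have ends: "(x \<in> \<Union>F1) \<noteq> (x \<in> \<Union>F2) \<longleftrightarrow> x \<in> z ` D" for x
    proof (cases "x \<in> z ` {..<m}")
      case True
      then obtain t where t: "t < m" "x = z t" by auto
      show ?thesis
        using F1 F2 zim[OF t(1)] flip[OF p] Sm Dm zv[OF t(1)] p
        by (auto simp: P_def t(2) D_def)
    next
      case False
      then have "x \<notin> z ` X" if "X \<subseteq> {..<m}" for X using that by auto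
      then show ?thesis using F1 F2 flip[OF p] Sm Dm by (auto simp: P_def)
    qed
    have "(z s \<in> \<Union>F1) \<noteq> (z s \<in> \<Union>F2)" by (rule ends[THEN iffD2, OF imageI[OF s]])
    from superposition_other_end[OF fin this] obtain y where
      y: "y \<noteq> z s" "{x \<in> component (F1 \<union> F2) (z s). x \<in> z ` D} = {z s, y}"
      unfolding ends by blast
    then have "y \<in> z ` D" by blast
    then obtain q where q: "q \<in> D" "y = z q" by auto
    have "{t \<in> D. z t \<in> component (F1 \<union> F2) (z s)} = {s, q}"
    proof (intro Set.set_eqI)
      fix t
      have "t \<in> D \<and> z t \<in> component (F1 \<union> F2) (z s) \<longleftrightarrow> t \<in> D \<and> z t \<in> {z s, z q}"
        using y(2) unfolding q(2) by blast
      also have "\<dots> \<longleftrightarrow> t \<in> {s, q}"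
        using s q(1) Dm inj by (auto dest: inj_onD)
      finally show "t \<in> {t \<in> D. z t \<in> component (F1 \<union> F2) (z s)} \<longleftrightarrow> t \<in> {s, q}" by simp
    qed
    moreover have "q \<noteq> s" using y q by auto
    ultimately show "\<exists>q. q \<noteq> s \<and> {t \<in> D. outs H ! t \<in> component (F1 \<union> F2) (outs H ! s)} = {s, q}"
      unfolding z_def by blast
  qed
  \<comment> \<open>The component is taken in \<open>F1 \<union> F2\<close>, which the exchange
    preserves; a second application finds the same component from its other end.\<close>
  define h where "h = (\<lambda>(p, F1, F2). (paired_outputs.partner H (F1 \<union> F2) D p,
    swap_on (component (F1 \<union> F2) (z p)) F1 F2, swap_on (component (F1 \<union> F2) (z p)) F2 F1))"
  define w where "w = (\<lambda>(p, F1, F2). (-1) ^ card {s \<in> D. s < p} * (prod (weight H) F1 * prod (weight H) F2))"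
  \<comment> \<open>Of the positions in \<open>D\<close>, only \<open>p\<close> and \<open>q\<close>
    lie in \<open>C\<close>. Hence \<open>sym_diff U {q}\<close> agrees with
    \<open>sym_diff V {p}\<close> inside \<open>C\<close> and with \<open>sym_diff U {p}\<close>
    outside. \<open>U\<close> and \<open>V\<close> are generic because the roles of \<open>S\<close>
    and \<open>T\<close> get interchanged.\<close>
  have half: "swap_on C A B \<in> P (sym_diff U {q})"
    if A: "A \<in> P (sym_diff U {p})" and B: "B \<in> P (sym_diff V {p})" and UV: "D = sym_diff U V"
      "U \<subseteq> {..<m}" "V \<subseteq> {..<m}" and pq: "p \<in> D" "q \<in> D" "p \<noteq> q"
      and C: "\<And>t. t \<in> D \<Longrightarrow> z t \<in> C \<longleftrightarrow> t = p \<or> t = q"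
      and clo: "\<And>e. e \<in> A \<union> B \<Longrightarrow> e \<inter> C \<noteq> {} \<Longrightarrow> e \<subseteq> C" for A B U V C p q
  proof -
    have AB: "matching A" "matching B" "\<Union>A = verts H - z ` sym_diff U {p}"
      "\<Union>B = verts H - z ` sym_diff V {p}" using A B by (auto simp: P_def)
    have usw: "\<Union>(swap_on C A B) = (\<Union>A - C) \<union> (\<Union>B \<inter> C)"
      by (rule Union_swap_on[OF AB(1,2)]) (rule clo)
    have "\<Union>(swap_on C A B) = verts H - z ` sym_diff U {q}"
    proof (rule Set.set_eqI)
      fix x
      show "x \<in> \<Union>(swap_on C A B) \<longleftrightarrow> x \<in> verts H - z ` sym_diff U {q}"
      proof (cases "x \<in> z ` {..<m}")
        case True
        then obtain t where t: "t < m" "x = z t" by auto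
        have "t \<in> sym_diff U {q} \<longleftrightarrow> (if x \<in> C then t \<in> sym_diff V {p} else t \<in> sym_diff U {p})"
        proof (cases "t \<in> D")
          case True
          then show ?thesis using C[OF True] t(2) pq UV(1) by auto
        next
          case False
          then show ?thesis using pq UV(1) by auto
        qed
        moreover have "x \<in> \<Union>(swap_on C A B) \<longleftrightarrow> (if x \<in> C then x \<in> \<Union>B else x \<in> \<Union>A)"
          unfolding usw
          by (cases "x \<in> C") (simp_all only: Un_iff Diff_iff Int_iff simp_thms if_True if_False not_True_eq_False not_False_eq_True)
        moreover have "x \<in> \<Union>A \<longleftrightarrow> t \<notin> sym_diff U {p}" "x \<in> \<Union>B \<longleftrightarrow> t \<notin> sym_diff V {p}"
          unfolding AB(3,4) t(2) by (intro zmem t(1) flip pq UV)+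
        moreover have "x \<in> verts H - z ` sym_diff U {q} \<longleftrightarrow> t \<notin> sym_diff U {q}"
          unfolding t(2) by (intro zmem t(1) flip pq UV)
        ultimately show ?thesis by presburger
      next
        \<comment> \<open>A vertex that is no output is covered by both matchings, before and after
          the exchange.\<close>
        case False
        then have "x \<notin> z ` X" if "X \<subseteq> {..<m}" for X using that by auto
        note this[OF flip[OF pq(1) UV(2)]] this[OF flip[OF pq(2) UV(2)]] this[OF flip[OF pq(1) UV(3)]]
        then show ?thesis
          unfolding usw AB(3,4) Un_iff Diff_iff Int_iff by blast
      qed
    qed
    moreover have "swap_on C A B \<subseteq> edges H" using A B by (auto simp: P_def swap_on_def)
    moreover have "matching (swap_on C A B)"
      by (rule matching_swap_on[OF AB(1,2)]) (rule clo)
    ultimately show ?thesis by (simp add: P_def)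
  qed
  have "(\<Sum>x\<in>?\<Omega>. w x) = 0"
  proof (rule sum_eq_0_of_sign_reversing_involution[where h = h])
    fix x assume "x \<in> ?\<Omega>"
    then obtain p F1 F2 where x: "x = (p, F1, F2)" and p: "p \<in> D"
      and F1: "F1 \<in> P (sym_diff S {p})" and F2: "F2 \<in> P (sym_diff T {p})" by auto
    interpret paired_outputs H "F1 \<union> F2" D by (rule pairing[OF p F1 F2])
    let ?C = "component (F1 \<union> F2) (z p)"
    let ?q = "partner p"
    have hx: "h x = (?q, swap_on ?C F1 F2, swap_on ?C F2 F1)" by (simp add: h_def x)
    have C: "z t \<in> ?C \<longleftrightarrow> t = p \<or> t = ?q" if "t \<in> D" for t
      using partner(2)[OF p] that unfolding z_def by blast
    have clo: "e \<subseteq> ?C" if "e \<in> F1 \<union> F2" "e \<inter> ?C \<noteq> {}" for e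
    proof -
      have "card e = 2" using that(1) F1 F2 by (auto simp: P_def matching_def)
      then show ?thesis using that component_edge[of _ "F1 \<union> F2" "z p" e] by blast
    qed
    have DS: "D = sym_diff S T" "D = sym_diff T S" by (auto simp: D_def)
    have clo': "e \<subseteq> ?C" if "e \<in> F2 \<union> F1" "e \<inter> ?C \<noteq> {}" for e
      using clo[of e] that by (simp add: Un_commute)
    have "swap_on ?C F1 F2 \<in> P (sym_diff S {?q})"
      by (rule half[OF F1 F2 DS(1) Sm p partner_in[OF p]])
        (rule partner(1)[OF p, symmetric] | erule C | erule (1) clo)+
    moreover have "swap_on ?C F2 F1 \<in> P (sym_diff T {?q})"
      by (rule half[OF F2 F1 DS(2) Sm(2,1) p partner_in[OF p]])
        (rule partner(1)[OF p, symmetric] | erule C | erule (1) clo')+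
    ultimately show "h x \<in> ?\<Omega>" using hx partner_in[OF p] by auto
    have "component (F1 \<union> F2) (z ?q) = ?C"
      using component_eq[OF partner_component[OF p]] by (simp add: z_def)
    then show "h (h x) = x"
      unfolding hx unfolding h_def by (simp add: swap_on_Un swap_on_swap_on partner_partner[OF p] x)
    have "finite F1" "finite F2" using F1 F2 finE by (auto simp: P_def intro: finite_subset)
    then show "w (h x) = - w x"
      unfolding hx unfolding w_def x by (simp add: prod_swap_on partner_sign[OF p])
  qed
  moreover have "finite D" using Dm finite_subset by blast
  ultimately have "(\<Sum>p\<in>D. \<Sum>y\<in>P (sym_diff S {p}) \<times> P (sym_diff T {p}). w (p, y)) = 0"
    by (subst sum.Sigma) (use finP in auto)
  moreover have "(\<Sum>y\<in>A \<times> B. w (p, y)) =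
      (-1) ^ card {s \<in> D. s < p} * ((\<Sum>F\<in>A. prod (weight H) F) * (\<Sum>F\<in>B. prod (weight H) F))" for A B p
    unfolding sum_product sum.cartesian_product by (simp add: w_def split_def sum_distrib_left)
  ultimately show ?thesis
    unfolding D_def[symmetric] sig by simp
qed

text \<open>A nonzero entry supplies a perfect matching of the remaining vertices, whose number is
  therefore even.\<close>

lemma signature_parity:
  assumes gate: "generator_matchgate H" and X: "X \<subseteq> {..<length (outs H)}" and nz: "signature H X \<noteq> 0"
  shows "even (card (verts H) + card X)"
proof -
  have wf: "wf_gate H" using gate by (simp add: generator_matchgate_def)
  let ?Z = "(!) (outs H) ` X"
  obtain F where "F \<in> perfect_matchings (del_verts H ?Z)"
    using nz unfolding signature_def perf_match_def by (meson sum.not_neutral_contains_not_neutral)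
  then have F: "matching F" "\<Union>F = verts H - ?Z" "F \<subseteq> edges H"
    by (auto simp: perfect_matchings_del_verts[OF wf])
  have "finite (verts H)" using wf by (simp add: wf_gate_def)
  then have "finite F" "\<And>e. e \<in> F \<Longrightarrow> finite e"
    using F(2) by (metis finite_Diff finite_UnionD, metis F(2) Sup_upper finite_Diff finite_subset)
  moreover have "pairwise disjnt F"
    using F(1)[unfolded matching_def] unfolding pairwise_def disjnt_def by meson
  ultimately have "card (\<Union>F) = (\<Sum>e\<in>F. card e)"
    by (simp add: card_Union_disjoint)
  also have "\<dots> = 2 * card F" using F(1) by (simp add: matching_def)
  finally have "card (verts H - ?Z) = 2 * card F" using F(2) by simp
  moreover have "?Z \<subseteq> verts H"
    using wf X unfolding wf_gate_def by (auto dest!: nth_mem)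
  moreover have "card ?Z = card X"
    using wf X by (intro card_image) (auto simp: inj_on_def wf_gate_def nth_eq_iff_index_eq subset_iff)
  ultimately have "card (verts H) = 2 * card F + card X"
    using card_Diff_subset[of ?Z "verts H"] card_mono[of "verts H" ?Z] finite_subset[of ?Z "verts H"]
      \<open>finite (verts H)\<close> by simp
  then show ?thesis by simp
qed


section \<open>Minors of the unfolding\<close>

lemma even_card_sym_diff:
  assumes "finite X" "finite Y"
  shows "even (card (sym_diff X Y)) \<longleftrightarrow> even (card X + card Y)"
proof -
  have "card (sym_diff X Y) = card (X - Y) + card (Y - X)"
    using assms by (intro card_Un_disjoint) auto
  moreover have "card X = card (X \<inter> Y) + card (X - Y)" "card Y = card (X \<inter> Y) + card (Y - X)"
    using assms card_Int_Diff[of X Y] card_Int_Diff[of Y X] by (auto simp: Int_commute)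
  ultimately show ?thesis by presburger
qed

lemma sym_diff_flip_both: "sym_diff (sym_diff X {p}) (sym_diff Y {p}) = sym_diff X Y"
  by blast

lemma sym_diff_Un_disjoint:
  assumes "X \<subseteq> A" "X' \<subseteq> A" "Y \<subseteq> B" "Y' \<subseteq> B" "A \<inter> B = {}"
  shows "sym_diff (X \<union> Y) (X' \<union> Y') = sym_diff X X' \<union> sym_diff Y Y'"
  using assms by blast

lemma underdetermined_system:
  fixes c :: "nat \<Rightarrow> nat \<Rightarrow> complex"
  assumes "k < n"
  shows "\<exists>x. (\<exists>j<n. x j \<noteq> 0) \<and> (\<forall>i<k. (\<Sum>j<n. c i j * x j) = 0)"
proof -
  \<comment> \<open>A square matrix made singular by a zero row at \<open>k\<close>; the rows after
    it merely impose further equations.\<close>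
  define A where "A = mat\<^sub>r n n (\<lambda>i. if i = k then 0\<^sub>v n else Matrix.vec n (c i))"
  have A: "A \<in> carrier_mat n n" by (simp add: A_def)
  have "det A = 0" unfolding A_def by (rule det_row_0[OF assms]) auto
  then obtain v where v: "v \<in> carrier_vec n" "v \<noteq> 0\<^sub>v n" "A *\<^sub>v v = 0\<^sub>v n"
    using det_0_iff_vec_prod_zero_field[OF A] by blast
  have "(\<Sum>j<n. c i j * vec_index v j) = 0" if "i < k" for i
  proof -
    have "row A i = Matrix.vec n (c i)"
      using that assms by (intro eq_vecI) (auto simp: A_def)
    then have "(\<Sum>j<n. c i j * vec_index v j) = vec_index (A *\<^sub>v v) i"
      using that assms v(1) A by (simp add: scalar_prod_def lessThan_atLeast0)
    then show ?thesis using v(3) that assms by simp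
  qed
  moreover have "\<exists>j<n. vec_index v j \<noteq> 0"
    using v(1,2) by (auto simp: Matrix.vec_eq_iff)
  ultimately show ?thesis by blast
qed

text \<open>
  The polarized identity reduces every minor of two rows to minors of rows of the other parity,
  up to minors of rows at the same Hamming distance; the latter are trivial if the distance is two,
  and otherwise an intermediate row is at smaller distance from both.
\<close>

lemma minors_of_other_parity:
  fixes f :: "nat set \<Rightarrow> complex"
  assumes mgi: "\<And>S T. S \<subseteq> {..<m} \<Longrightarrow> T \<subseteq> {..<m} \<Longrightarrow>
      (\<Sum>p\<in>sym_diff S T. (-1) ^ card {s \<in> sym_diff S T. s < p} *
        (f (sym_diff S {p}) * f (sym_diff T {p}))) = 0"
    and A: "A = {lo..<hi}" "hi \<le> m" and B: "B = {..<m} - A"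
    and zero: "\<And>a a' b b'. a \<subseteq> A \<Longrightarrow> a' \<subseteq> A \<Longrightarrow> even (card a) \<noteq> \<epsilon> \<Longrightarrow> even (card a') \<noteq> \<epsilon> \<Longrightarrow>
      b \<subseteq> B \<Longrightarrow> b' \<subseteq> B \<Longrightarrow> f (a \<union> b) * f (a' \<union> b') = f (a \<union> b') * f (a' \<union> b)"
  shows "a \<subseteq> A \<Longrightarrow> a' \<subseteq> A \<Longrightarrow> even (card a) = \<epsilon> \<Longrightarrow> even (card a') = \<epsilon> \<Longrightarrow>
      b \<subseteq> B \<Longrightarrow> b' \<subseteq> B \<Longrightarrow> f (a \<union> b) * f (a' \<union> b') = f (a \<union> b') * f (a' \<union> b)"
proof (induction "card (sym_diff a a')" arbitrary: a a' b b' rule: less_induct)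
  case less
  have finA: "finite A" by (simp add: A)
  have fin: "finite a" "finite a'" using less.prems finA by (auto intro: finite_subset)
  define \<Delta> where "\<Delta> = sym_diff a a'"
  have \<Delta>A: "\<Delta> \<subseteq> A" "finite \<Delta>" using less.prems fin by (auto simp: \<Delta>_def)
  have "even (card \<Delta>)" unfolding \<Delta>_def even_card_sym_diff[OF fin] using less.prems by auto
  define D where "D = \<Delta> \<union> sym_diff b b'"
  have "D \<subseteq> {..<m}" using \<Delta>A less.prems(5,6) A B by (auto simp: D_def)
  then have finD: "finite D" by (rule finite_subset) simp
  \<comment> \<open>The minor of rows \<open>x\<close>, \<open>x'\<close> and columns
    \<open>b\<close>, \<open>b'\<close>.\<close>
  define W where "W = (\<lambda>x x'. f (x \<union> b) * f (x' \<union> b') - f (x \<union> b') * f (x' \<union> b))"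
  define sg where "sg = (\<lambda>r. (-1 :: complex) ^ card {s \<in> D. s < r})"
  show ?case
  proof (cases "\<Delta> = {}")
    case True
    then have "a = a'" by (auto simp: \<Delta>_def)
    then show ?thesis by (simp add: mult.commute)
  next
    case False
    \<comment> \<open>Flipping \<open>p\<close> moves both rows to the parity where
      \<open>zero\<close> applies. The least element is taken so that \<open>p < q\<close> when only
      one other element \<open>q\<close> is left.\<close>
    define p where "p = Min \<Delta>"
    have p: "p \<in> \<Delta>" "\<And>q. q \<in> \<Delta> \<Longrightarrow> p \<le> q" using False \<Delta>A by (auto simp: p_def)
    define u u' where "u = sym_diff a {p}" and "u' = sym_diff a' {p}"
    have u: "u \<subseteq> A" "u' \<subseteq> A" using less.prems p \<Delta>A by (auto simp: u_def u'_def)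
    have up: "even (card u) \<noteq> \<epsilon>" "even (card u') \<noteq> \<epsilon>"
      unfolding u_def u'_def using even_card_sym_diff[of a "{p}"] even_card_sym_diff[of a' "{p}"]
        fin less.prems by auto
    \<comment> \<open>A flip inside the block yields a minor of two rows that again differ in
      \<Delta>, for \<open>r = p\<close> the wanted one; a flip outside changes columns only and
      leaves a minor of \<open>u\<close> and \<open>u'\<close>, which vanishes.\<close>
    have polar: "f (sym_diff (u \<union> b) {r}) * f (sym_diff (u' \<union> b') {r}) -
        f (sym_diff (u \<union> b') {r}) * f (sym_diff (u' \<union> b) {r}) =
        (if r \<in> \<Delta> then W (sym_diff u {r}) (sym_diff u' {r}) else 0)" if r: "r \<in> D" for r
    proof (cases "r \<in> \<Delta>")
      case True
      then have "r \<in> A" "r \<notin> B" using \<Delta>A B by auto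
      then have "sym_diff (x \<union> y) {r} = sym_diff x {r} \<union> y" if "y \<subseteq> B" for x y using that by auto
      then show ?thesis using True less.prems by (simp add: W_def)
    next
      case False
      then have rB: "r \<in> B" "r \<notin> A" using r less.prems B by (auto simp: D_def)
      then have e: "sym_diff (x \<union> y) {r} = x \<union> sym_diff y {r}" if "x \<subseteq> A" for x y using that by auto
      have "sym_diff b {r} \<subseteq> B" "sym_diff b' {r} \<subseteq> B" using less.prems rB by auto
      then have "f (u \<union> sym_diff b {r}) * f (u' \<union> sym_diff b' {r}) =
          f (u \<union> sym_diff b' {r}) * f (u' \<union> sym_diff b {r})"
        by (rule zero[OF u up])
      then show ?thesis using False by (simp add: e[OF u(1)] e[OF u(2)])
    qed
    have Dis: "sym_diff (u \<union> b) (u' \<union> b') = D" "sym_diff (u \<union> b') (u' \<union> b) = D"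
    proof -
      have uu: "sym_diff u u' = \<Delta>" unfolding u_def u'_def \<Delta>_def by (rule sym_diff_flip_both)
      have AB: "A \<inter> B = {}" using B by blast
      show "sym_diff (u \<union> b) (u' \<union> b') = D" "sym_diff (u \<union> b') (u' \<union> b) = D"
        unfolding sym_diff_Un_disjoint[OF u less.prems(5,6) AB] sym_diff_Un_disjoint[OF u less.prems(6,5) AB]
          uu D_def by (simp_all only: Un_commute)
    qed
    have sub: "u \<union> b \<subseteq> {..<m}" "u' \<union> b' \<subseteq> {..<m}" "u \<union> b' \<subseteq> {..<m}" "u' \<union> b \<subseteq> {..<m}"
      using u less.prems A B by auto
    \<comment> \<open>The identity for columns \<open>b\<close>, \<open>b'\<close> minus the one
      with the columns interchanged; both sums run over \<open>D\<close> with the same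
      signs.\<close>
    have "0 = (\<Sum>r\<in>D. sg r * (f (sym_diff (u \<union> b) {r}) * f (sym_diff (u' \<union> b') {r}) -
        f (sym_diff (u \<union> b') {r}) * f (sym_diff (u' \<union> b) {r})))"
      using mgi[OF sub(1,2)] mgi[OF sub(3,4)] unfolding Dis
      by (simp add: sg_def right_diff_distrib sum_subtractf)
    also have "\<dots> = (\<Sum>r\<in>D. if r \<in> \<Delta> then sg r * W (sym_diff u {r}) (sym_diff u' {r}) else 0)"
      by (intro sum.cong refl) (simp add: polar)
    also have "\<dots> = (\<Sum>r\<in>\<Delta>. sg r * W (sym_diff u {r}) (sym_diff u' {r}))"
      using finD by (subst sum.inter_restrict[symmetric]) (auto simp: D_def Int_absorb1)
    also have "\<dots> = sg p * W a a' + (\<Sum>r\<in>\<Delta> - {p}. sg r * W (sym_diff u {r}) (sym_diff u' {r}))"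
    proof -
      have "sym_diff u {p} = a" "sym_diff u' {p} = a'" by (auto simp: u_def u'_def)
      then show ?thesis
        using sum.remove[OF \<Delta>A(2) p(1), of "\<lambda>r. sg r * W (sym_diff u {r}) (sym_diff u' {r})"]
        by (simp only:)
    qed
    finally have main: "sg p * W a a' + (\<Sum>r\<in>\<Delta> - {p}. sg r * W (sym_diff u {r}) (sym_diff u' {r})) = 0"
      by simp
    have sg0: "sg p \<noteq> 0" by (simp add: sg_def)
    show ?thesis
    proof (cases "card \<Delta> = 2")
      case True
      then have "card (\<Delta> - {p}) = 1" using p \<Delta>A by simp
      then obtain q where q: "\<Delta> - {p} = {q}" by (auto simp: card_1_singleton_iff)
      then have \<Delta>pq: "\<Delta> = {p, q}" "p \<noteq> q" using p(1) by auto
      then have "p < q" using p(2)[of q] by auto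
      have "p \<in> D" "q \<in> D" unfolding D_def \<Delta>pq(1) by blast+
      \<comment> \<open>The block is an interval and \<open>D\<close> meets it only in
        \<open>p\<close> and \<open>q\<close>, so nothing of \<open>D\<close> separates them. The
        signs are opposite and so are the minors; the two terms add up instead of
        cancelling.\<close>
      moreover have "{s \<in> D. p < s \<and> s < q} = {}"
        using \<Delta>A less.prems unfolding D_def \<Delta>pq(1) B A by auto
      ultimately have "sg q = - sg p"
        unfolding sg_def using sign_flip_of_even_between[OF finD _ _ \<open>p < q\<close>]
        by (metis card.empty even_zero)
      moreover have "sym_diff u {q} = a'" "sym_diff u' {q} = a"
        using \<Delta>pq unfolding u_def u'_def \<Delta>_def by blast+
      moreover have "W a' a = - W a a'" by (simp add: W_def)
      ultimately have "2 * (sg p * W a a') = 0" using main unfolding q by simp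
      then show ?thesis using sg0 by (simp add: W_def)
    next
      case False
      \<comment> \<open>If all other rows in the sum vanish, only the term for \<open>p\<close> is
        left. Otherwise some nonzero row \<open>v\<close> differs from one of \<open>a\<close>,
        \<open>a'\<close> in \<open>{p, r}\<close> and from the other in the rest of \<Delta>, both
        smaller than \<Delta>.\<close>
      have "W a a' = 0"
      proof (cases "\<exists>r\<in>\<Delta> - {p}. \<exists>c\<subseteq>B. f (sym_diff u {r} \<union> c) \<noteq> 0 \<or> f (sym_diff u' {r} \<union> c) \<noteq> 0")
        case False
        then have "W (sym_diff u {r}) (sym_diff u' {r}) = 0" if "r \<in> \<Delta> - {p}" for r
          using that less.prems(5,6) by (auto simp: W_def)
        then show ?thesis using main sg0 by simp
      next
        case True
        then obtain r c v where r: "r \<in> \<Delta>" "r \<noteq> p" and c: "c \<subseteq> B" and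
          v: "v = sym_diff u {r} \<or> v = sym_diff u' {r}" and nz: "f (v \<union> c) \<noteq> 0" by blast
        have vA: "v \<subseteq> A" using v u r \<Delta>A by auto
        have "even (card v) = \<epsilon>"
          using v up even_card_sym_diff[of u "{r}"] even_card_sym_diff[of u' "{r}"] u finA
          by (auto dest: finite_subset)
        have "card \<Delta> \<noteq> 0" using p(1) \<Delta>A(2) by auto
        then have "card \<Delta> > 2" using \<open>even (card \<Delta>)\<close> \<open>card \<Delta> \<noteq> 2\<close> by presburger
        have pr: "{p, r} \<subseteq> \<Delta>" "card {p, r} = 2" using r p by auto
        have "card (\<Delta> - {p, r}) < card \<Delta>"
          using pr \<Delta>A by (intro psubset_card_mono) auto
        have sd: "sym_diff a v = {p, r} \<and> sym_diff v a' = \<Delta> - {p, r} \<or>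
            sym_diff a v = \<Delta> - {p, r} \<and> sym_diff v a' = {p, r}"
          using v pr(1) r(2) unfolding u_def u'_def \<Delta>_def by blast
        have 1: "card (sym_diff a v) < card (sym_diff a a')" and 2: "card (sym_diff v a') < card (sym_diff a a')"
          unfolding \<Delta>_def[symmetric]
          using sd pr(2) \<open>card \<Delta> > 2\<close> \<open>card (\<Delta> - {p, r}) < card \<Delta>\<close> by metis+
        have ih1: "f (a \<union> y) * f (v \<union> c) = f (a \<union> c) * f (v \<union> y)" if "y \<subseteq> B" for y
          by (rule less.hyps[OF 1 less.prems(1) vA less.prems(3) \<open>even (card v) = \<epsilon>\<close> that c])
        have ih2: "f (v \<union> c) * f (a' \<union> y) = f (v \<union> y) * f (a' \<union> c)" if "y \<subseteq> B" for y
          by (rule less.hyps[OF 2 vA less.prems(2) \<open>even (card v) = \<epsilon>\<close> less.prems(4) c that])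
        \<comment> \<open>Both rows are proportional to row \<open>v\<close>; multiplying by the
          square of its nonzero entry avoids division.\<close>
        have "f (v \<union> c) * f (v \<union> c) * W a a' =
            (f (a \<union> b) * f (v \<union> c)) * (f (v \<union> c) * f (a' \<union> b')) -
            (f (a \<union> b') * f (v \<union> c)) * (f (v \<union> c) * f (a' \<union> b))"
          by (simp add: W_def algebra_simps)
        also have "\<dots> = 0"
          unfolding ih1[OF less.prems(5)] ih1[OF less.prems(6)] ih2[OF less.prems(5)] ih2[OF less.prems(6)]
          by simp
        finally show ?thesis using nz by simp
      qed
      then show ?thesis by (simp add: W_def)
    qed
  qed
qed

lemma nonzero_minor_solve:
  fixes c d :: complex
  assumes "c * x + d * y = 0" "c * x' + d * y' = 0" "x * y' \<noteq> x' * y"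
  shows "c = 0 \<and> d = 0"
proof -
  have "c * (x * y' - x' * y) = (c * x + d * y) * y' - (c * x' + d * y') * y"
    "d * (x * y' - x' * y) = (c * x' + d * y') * x - (c * x + d * y) * x'"
    by (simp_all add: algebra_simps)
  then show ?thesis using assms by auto
qed

text \<open>\<open>fac\<close> factors a matrix through dimension 3, with independent columns of
  \<open>M\<close> (\<open>Minj\<close>) and independent rows of \<open>N\<close>
  (\<open>Ninj\<close>). Explicit vectors stand in for ranks: if both parities are flat, some
  nonzero vector is killed by \<open>M\<close>; if neither is, four rows in dimension 3 would be
  independent.\<close>

lemma no_rank_3_factorization:
  fixes f :: "nat set \<Rightarrow> complex" and M :: "nat set \<Rightarrow> nat \<Rightarrow> complex" and N :: "nat \<Rightarrow> nat set \<Rightarrow> complex"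
  assumes mgi: "\<And>S T. S \<subseteq> {..<m} \<Longrightarrow> T \<subseteq> {..<m} \<Longrightarrow>
      (\<Sum>p\<in>sym_diff S T. (-1) ^ card {s \<in> sym_diff S T. s < p} *
        (f (sym_diff S {p}) * f (sym_diff T {p}))) = 0"
    and parity: "\<And>X. X \<subseteq> {..<m} \<Longrightarrow> f X \<noteq> 0 \<Longrightarrow> even (\<kappa> + card X)"
    and A: "A = {lo..<hi}" "hi \<le> m" and B: "B = {..<m} - A"
    and fac: "\<And>a b. a \<subseteq> A \<Longrightarrow> b \<subseteq> B \<Longrightarrow> f (a \<union> b) = (\<Sum>j<3. M a j * N j b)"
    and Minj: "\<And>x. (\<And>a. a \<subseteq> A \<Longrightarrow> (\<Sum>j<3. M a j * x j) = 0) \<Longrightarrow> (\<And>j. j < 3 \<Longrightarrow> x j = 0)"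
    and Ninj: "\<And>x. (\<And>b. b \<subseteq> B \<Longrightarrow> (\<Sum>j<3. x j * N j b) = 0) \<Longrightarrow> (\<And>j. j < 3 \<Longrightarrow> x j = 0)"
  shows False
proof -
  \<comment> \<open>Rank at most 1 for the rows of one parity, expressed by minors.\<close>
  define flat where "flat = (\<lambda>\<epsilon>. \<forall>a a' b b'. a \<subseteq> A \<longrightarrow> a' \<subseteq> A \<longrightarrow> even (card a) = \<epsilon> \<longrightarrow> even (card a') = \<epsilon> \<longrightarrow>
      b \<subseteq> B \<longrightarrow> b' \<subseteq> B \<longrightarrow> f (a \<union> b) * f (a' \<union> b') = f (a \<union> b') * f (a' \<union> b))"
  have flip: "flat \<epsilon>" if "flat (\<not> \<epsilon>)" for \<epsilon>
    unfolding flat_def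
  proof (intro allI impI)
    fix a a' b b'
    assume *: "a \<subseteq> A" "a' \<subseteq> A" "even (card a) = \<epsilon>" "even (card a') = \<epsilon>" "b \<subseteq> B" "b' \<subseteq> B"
    show "f (a \<union> b) * f (a' \<union> b') = f (a \<union> b') * f (a' \<union> b)"
    proof (rule minors_of_other_parity[OF mgi A B _ *])
      fix a a' b b'
      assume "a \<subseteq> A" "a' \<subseteq> A" "even (card a) \<noteq> \<epsilon>" "even (card a') \<noteq> \<epsilon>" "b \<subseteq> B" "b' \<subseteq> B"
      then show "f (a \<union> b) * f (a' \<union> b') = f (a \<union> b') * f (a' \<union> b)"
        using that unfolding flat_def by blast
    qed
  qed
  \<comment> \<open>\<open>Ninj\<close> lifts proportionality from the rows of \<open>f\<close> to
    those of \<open>M\<close>.\<close>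
  have span: "\<exists>u. \<forall>a\<subseteq>A. even (card a) = \<epsilon> \<longrightarrow> (\<exists>c. \<forall>j<3. M a j = c * u j)" if fl: "flat \<epsilon>" for \<epsilon>
  proof (cases "\<exists>a\<subseteq>A. even (card a) = \<epsilon> \<and> (\<exists>j<3. M a j \<noteq> 0)")
    case False
    then have "\<forall>a\<subseteq>A. even (card a) = \<epsilon> \<longrightarrow> (\<exists>c. \<forall>j<3. M a j = c * 0)" by auto
    then show ?thesis by (intro exI[of _ "\<lambda>_. 0"]) auto
  next
    case True
    then obtain a0 where a0: "a0 \<subseteq> A" "even (card a0) = \<epsilon>" "\<exists>j<3. M a0 j \<noteq> 0" by auto
    then obtain b0 where b0: "b0 \<subseteq> B" "f (a0 \<union> b0) \<noteq> 0"
      using Ninj[of "M a0"] fac[OF a0(1)] by metis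
    have "\<forall>j<3. M a j = (f (a \<union> b0) / f (a0 \<union> b0)) * M a0 j" if a: "a \<subseteq> A" "even (card a) = \<epsilon>" for a
    proof -
      define x where "x = (\<lambda>j. f (a0 \<union> b0) * M a j - f (a \<union> b0) * M a0 j)"
      have "x j = 0" if "j < 3" for j
      proof (rule Ninj[OF _ that])
        fix b assume b: "b \<subseteq> B"
        have "(\<Sum>j<3. x j * N j b) = f (a0 \<union> b0) * f (a \<union> b) - f (a \<union> b0) * f (a0 \<union> b)"
          unfolding fac[OF a(1) b] fac[OF a0(1) b]
          by (simp add: x_def left_diff_distrib sum_subtractf sum_distrib_left mult.assoc)
        also have "\<dots> = 0" using fl a a0 b b0(1) unfolding flat_def by (simp add: mult.commute)
        finally show "(\<Sum>j<3. x j * N j b) = 0" .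
      qed
      then show ?thesis using b0 by (auto simp: x_def field_simps)
    qed
    then show ?thesis by (intro exI[of _ "M a0"]) blast
  qed
  show False
  proof (cases "flat True \<or> flat False")
    case True
    then have "flat True" "flat False" using flip[of True] flip[of False] by auto
    then obtain u v where
      u: "\<And>a. a \<subseteq> A \<Longrightarrow> even (card a) = True \<Longrightarrow> \<exists>c. \<forall>j<3. M a j = c * u j" and
      v: "\<And>a. a \<subseteq> A \<Longrightarrow> even (card a) = False \<Longrightarrow> \<exists>c. \<forall>j<3. M a j = c * v j"
      using span[of True] span[of False] by metis
    \<comment> \<open>Two equations in three unknowns: \<open>x\<close> is annihilated by both
      spanning rows, hence by every row of \<open>M\<close>.\<close>
    obtain x where x: "\<exists>j<3. x j \<noteq> 0" "\<And>i. i < 2 \<Longrightarrow> (\<Sum>j<3. (if i = (0::nat) then u else v) j * x j) = 0"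
      using underdetermined_system[of 2 3 "\<lambda>i. if i = (0::nat) then u else v"] by fastforce
    have xu: "(\<Sum>j<3. u j * x j) = 0" "(\<Sum>j<3. v j * x j) = 0" using x(2)[of 0] x(2)[of 1] by auto
    have "(\<Sum>j<3. M a j * x j) = 0" if aA: "a \<subseteq> A" for a
    proof -
      obtain w c where w: "w = u \<or> w = v" "\<forall>j<3. M a j = c * w j"
        using u[OF aA] v[OF aA] by (cases "even (card a)") auto
      then have "(\<Sum>j<3. M a j * x j) = c * (\<Sum>j<3. w j * x j)"
        by (simp add: sum_distrib_left mult.assoc)
      then show ?thesis using w(1) xu by auto
    qed
    then show False using Minj[of x] x(1) by blast
  next
    case False
    then obtain a1 a2 b1 b2 where 1: "a1 \<subseteq> A" "a2 \<subseteq> A" "even (card a1)" "even (card a2)" "b1 \<subseteq> B" "b2 \<subseteq> B"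
      "f (a1 \<union> b1) * f (a2 \<union> b2) \<noteq> f (a1 \<union> b2) * f (a2 \<union> b1)"
      unfolding flat_def by auto
    from False obtain a3 a4 b3 b4 where 2: "a3 \<subseteq> A" "a4 \<subseteq> A" "odd (card a3)" "odd (card a4)" "b3 \<subseteq> B" "b4 \<subseteq> B"
      "f (a3 \<union> b3) * f (a4 \<union> b4) \<noteq> f (a3 \<union> b4) * f (a4 \<union> b3)"
      unfolding flat_def by auto
    define as where "as = (\<lambda>i::nat. if i = 0 then a1 else if i = 1 then a2 else if i = 2 then a3 else a4)"
    \<comment> \<open>The rows of the two nonzero minors, two even and two odd, are dependent in
      dimension 3.\<close>
    obtain c where c: "\<exists>i<4. c i \<noteq> 0" "\<And>j. j < 3 \<Longrightarrow> (\<Sum>i<4. M (as i) j * c i) = 0"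
      using underdetermined_system[of 3 4 "\<lambda>j i. M (as i) j"] by fastforce
    have asA: "as i \<subseteq> A" for i using 1 2 by (auto simp: as_def)
    have comb: "(\<Sum>i<4. c i * f (as i \<union> b)) = 0" if b: "b \<subseteq> B" for b
    proof -
      have "(\<Sum>i<4. c i * f (as i \<union> b)) = (\<Sum>i<4. \<Sum>j<3. c i * (M (as i) j * N j b))"
        by (simp add: fac[OF asA b] sum_distrib_left)
      also have "\<dots> = (\<Sum>j<3. \<Sum>i<4. c i * (M (as i) j * N j b))" by (rule sum.swap)
      also have "\<dots> = (\<Sum>j<3. (\<Sum>i<4. M (as i) j * c i) * N j b)"
        by (simp add: sum_distrib_right sum_distrib_left mult_ac)
      finally show ?thesis using c(2) by simp
    qed
    have comb4: "c 0 * f (a1 \<union> b) + c 1 * f (a2 \<union> b) + (c 2 * f (a3 \<union> b) + c 3 * f (a4 \<union> b)) = 0"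
      if "b \<subseteq> B" for b
      using comb[OF that] by (simp add: as_def eval_nat_numeral add.assoc)
    have par: "f (a \<union> b) = 0 \<or> (even (card a) \<longleftrightarrow> even (\<kappa> + card b))" if "a \<subseteq> A" "b \<subseteq> B" for a b
    proof -
      have "a \<union> b \<subseteq> {..<m}" using that A B by auto
      moreover have "card (a \<union> b) = card a + card b"
        using that A B by (intro card_Un_disjoint) (auto intro: finite_subset)
      ultimately show ?thesis using parity[of "a \<union> b"] by auto
    qed
    \<comment> \<open>For each \<open>b\<close>, parity annihilates either the even or the odd
      entries, so the dependence splits; each nonzero minor then forces its two coefficients to
      vanish.\<close>
    have sep: "c 0 * f (a1 \<union> b) + c 1 * f (a2 \<union> b) = 0 \<and> c 2 * f (a3 \<union> b) + c 3 * f (a4 \<union> b) = 0"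
      if b: "b \<subseteq> B" for b
      using comb4[OF b] par[OF 1(1) b] par[OF 1(2) b] par[OF 2(1) b] par[OF 2(2) b] 1(3,4) 2(3,4)
      by (cases "even (\<kappa> + card b)") auto
    have "c 0 = 0 \<and> c 1 = 0"
      by (rule nonzero_minor_solve[of _ "f (a1 \<union> b1)" _ "f (a2 \<union> b1)" "f (a1 \<union> b2)" "f (a2 \<union> b2)"])
        (use sep[OF 1(5)] sep[OF 1(6)] 1(7) in auto)
    moreover have "c 2 = 0 \<and> c 3 = 0"
      by (rule nonzero_minor_solve[of _ "f (a3 \<union> b3)" _ "f (a4 \<union> b3)" "f (a3 \<union> b4)" "f (a4 \<union> b4)"])
        (use sep[OF 2(5)] sep[OF 2(6)] 2(7) in auto)
    moreover obtain i where "i < 4" "c i \<noteq> 0" using c(1) by auto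
    moreover have "i = 0 \<or> i = 1 \<or> i = 2 \<or> i = 3" using \<open>i < 4\<close> by auto
    ultimately show False by auto
  qed
qed


section \<open>Indexing of tensors\<close>

lemma (in vec_space) rank_witness:
  assumes "A \<in> carrier_mat n k"
  obtains S where "S \<subseteq> set (cols A)" "lin_indpt S" "card S = rank A"
proof -
  obtain S where S: "maximal S (\<lambda>T. T \<subseteq> set (cols A) \<and> lin_indpt T)"
    using maximal_exists[of "(\<lambda>T. T \<subseteq> set (cols A) \<and> lin_indpt T)" "card (set (cols A))" "{}"]
    by (meson List.finite_set card_mono empty_iff empty_subsetI finite_lin_indpt2 rev_finite_subset)
  then show thesis using rank_card_indpt[OF assms S] that[of S] by (simp add: maximal_def)
qed

text \<open>Independence concerns the set of columns, so the rank has to rule out repeated columns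
  before a null vector yields a dependence.\<close>

lemma full_col_rank_inj:
  fixes A :: "complex mat"
  assumes A: "A \<in> carrier_mat n k" and rank: "vec_space.rank n A = k"
    and v: "v \<in> carrier_vec k" "A *\<^sub>v v = 0\<^sub>v n"
  shows "v = 0\<^sub>v k"
proof -
  interpret vec_space "TYPE(complex)" n .
  obtain S where S: "S \<subseteq> set (cols A)" "card S = rank A" using rank_witness[OF A] .
  then have "k \<le> card (set (cols A))" using rank by (metis List.finite_set card_mono)
  then have dist: "distinct (cols A)"
    using A by (metis card_distinct card_length carrier_matD(2) cols_length le_antisym)
  then have "lin_indpt (set (cols A))" by (rule full_rank_lin_indpt[OF A rank])
  then show ?thesis using lin_depI[OF A v(1) _ v(2) dist] by blast
qed

text \<open>Some \<open>n\<close> independent columns form an invertible square matrix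
  \<open>C\<close>, and \<open>x\<close> is a null vector of its transpose.\<close>

lemma full_row_rank_inj:
  fixes A :: "complex mat"
  assumes A: "A \<in> carrier_mat n k" and rank: "vec_space.rank n A = n"
    and x: "x \<in> carrier_vec n" "\<And>j. j < k \<Longrightarrow> col A j \<bullet> x = 0"
  shows "x = 0\<^sub>v n"
proof -
  interpret vec_space "TYPE(complex)" n .
  obtain S where SA: "S \<subseteq> set (cols A)" "lin_indpt S" and "card S = rank A"
    using rank_witness[OF A] .
  then have Sn: "card S = n" using rank by simp
  have "finite S" using SA by (auto intro: finite_subset)
  then obtain xs where xs: "set xs = S" "distinct xs" using finite_distinct_list by blast
  then have len: "length xs = n" using Sn distinct_card by fastforce
  have xsc: "set xs \<subseteq> carrier_vec n" using SA xs cols_dim A by (metis carrier_matD(1) subset_trans)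
  define C where "C = mat_of_cols n xs"
  have C: "C \<in> carrier_mat n n" using len by (simp add: C_def carrier_matI)
  have cols: "cols C = xs" unfolding C_def by (rule cols_mat_of_cols[OF xsc])
  have "rank C = n"
    by (rule lin_indpt_full_rank[OF C]) (simp_all add: cols xs SA)
  then have "det C \<noteq> 0" using det_rank_iff[OF C] by simp
  then have d: "det C\<^sup>T \<noteq> 0" by (simp add: det_transpose[OF C])
  have "C\<^sup>T *\<^sub>v x = 0\<^sub>v n"
  proof (rule eq_vecI)
    fix i assume "i < dim_vec (0\<^sub>v n :: complex Matrix.vec)"
    then have i: "i < n" by simp
    have "xs ! i \<in> set (cols A)" using i len xs SA by (metis nth_mem subsetD)
    then obtain j where j: "j < k" "xs ! i = col A j"
      using A by (auto simp: in_set_conv_nth)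
    have "row C\<^sup>T i = col C i" using i C by simp
    also have "\<dots> = col A j" using i C j(2) cols cols_nth[of i C] by simp
    finally have "row C\<^sup>T i = col A j" .
    then show "vec_index (C\<^sup>T *\<^sub>v x) i = vec_index (0\<^sub>v n) i"
      using i C x(2)[OF j(1)] by simp
  qed (use C in auto)
  then show ?thesis
    using d x(1) det_0_iff_vec_prod_zero_field[of "C\<^sup>T" n] C by (meson transpose_carrier_mat)
qed

section \<open>Words and their lexicographic numbers\<close>

definition words :: "nat \<Rightarrow> nat \<Rightarrow> nat list set" where
  "words k n = {w. length w = n \<and> set w \<subseteq> {..<k}}"

definition insert_at :: "nat \<Rightarrow> nat \<Rightarrow> nat list \<Rightarrow> nat list" where
  "insert_at t j w = take t w @ [j] @ drop t w"

text \<open>The entry of a tensor power of \<open>M\<close> in the row \<open>w\<close> and the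
  column \<open>c\<close>, as \<open>tensor_power_entry\<close> confirms.\<close>

definition prod_entries :: "complex mat \<Rightarrow> nat list \<Rightarrow> nat list \<Rightarrow> complex" where
  "prod_entries M w c = prod_list (map2 (\<lambda>i j. M $$ (i, j)) w c)"

lemma length_words: "w \<in> words k n \<Longrightarrow> length w = n"
  by (simp add: words_def)

lemma words_0 [simp]: "words k 0 = {[]}"
  by (auto simp: words_def)

lemma Cons_words: "j # w \<in> words k (Suc n) \<longleftrightarrow> j < k \<and> w \<in> words k n"
  by (auto simp: words_def)

lemma words_SucE:
  assumes "c \<in> words k (Suc n)"
  obtains j w where "c = j # w" "j < k" "w \<in> words k n"
  using assms by (cases c) (auto simp: words_def)

lemma insert_at_words: "t \<le> n \<Longrightarrow> j < k \<Longrightarrow> w \<in> words k n \<Longrightarrow> insert_at t j w \<in> words k (Suc n)"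
  by (auto simp: words_def insert_at_def dest: in_set_takeD in_set_dropD)

lemma finite_words [simp]: "finite (words k n)"
  using finite_lists_length_eq[of "{..<k}" n] by (simp add: words_def conj_commute)

lemma sum_words_insert_at:
  assumes "t \<le> n"
  shows "sum g (words k (Suc n)) = (\<Sum>j<k. \<Sum>w\<in>words k n. g (insert_at t j w))"
proof -
  have "(\<Sum>j<k. \<Sum>w\<in>words k n. g (insert_at t j w)) =
      (\<Sum>(j, w)\<in>{..<k} \<times> words k n. g (insert_at t j w))"
    by (rule sum.cartesian_product)
  also have "\<dots> = sum g (words k (Suc n))"
  proof (rule sum.reindex_bij_witness[where i = "\<lambda>c. (c ! t, take t c @ drop (Suc t) c)" and
        j = "\<lambda>(j, w). insert_at t j w"])
    fix a assume "a \<in> {..<k} \<times> words k n"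
    then show "((case a of (j, w) \<Rightarrow> insert_at t j w) ! t,
        take t (case a of (j, w) \<Rightarrow> insert_at t j w) @ drop (Suc t) (case a of (j, w) \<Rightarrow> insert_at t j w)) = a"
      using assms by (auto simp: insert_at_def words_def nth_append)
  next
    fix c assume c: "c \<in> words k (Suc n)"
    then have "c ! t \<in> set c" using assms by (simp add: words_def)
    then have "c ! t < k" using c by (auto simp: words_def)
    then show "(case (c ! t, take t c @ drop (Suc t) c) of (j, w) \<Rightarrow> insert_at t j w) = c"
      "(c ! t, take t c @ drop (Suc t) c) \<in> {..<k} \<times> words k n"
      using assms c
      by (auto simp: insert_at_def words_def id_take_nth_drop[symmetric] dest: in_set_takeD in_set_dropD)
  qed (use assms insert_at_words in auto)
  finally show ?thesis by simp
qed

lemma sum_words_Suc: "sum g (words k (Suc n)) = (\<Sum>j<k. \<Sum>w\<in>words k n. g (j # w))"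
  using sum_words_insert_at[of 0 n g k] by (simp add: insert_at_def)

lemma prod_entries_Cons [simp]: "prod_entries M (i # w) (j # c) = M $$ (i, j) * prod_entries M w c"
  by (simp add: prod_entries_def)

lemma prod_entries_insert_at:
  assumes "length w = length c" "t \<le> length c"
  shows "prod_entries M (insert_at t i w) (insert_at t j c) = M $$ (i, j) * prod_entries M w c"
proof -
  have "prod_entries M w c = prod_entries M (take t w @ drop t w) (take t c @ drop t c)" by simp
  also have "\<dots> = prod_entries M (take t w) (take t c) * prod_entries M (drop t w) (drop t c)"
    unfolding prod_entries_def using assms by (subst zip_append) auto
  finally show ?thesis
    using assms by (simp add: prod_entries_def insert_at_def)
qed

lemma lex_index_append: "lex_index k (xs @ ys) = lex_index k xs * k ^ length ys + lex_index k ys"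
proof (induction ys rule: rev_induct)
  case Nil
  then show ?case by (simp add: lex_index_def)
next
  case (snoc y ys)
  have "lex_index k (xs @ ys @ [y]) = lex_index k (xs @ ys) * k + y"
    using lex_index_snoc[of k "xs @ ys" y] by simp
  then show ?case using snoc by (simp add: lex_index_snoc algebra_simps)
qed

lemma lex_index_Cons: "lex_index k (j # w) = j * k ^ length w + lex_index k w"
  using lex_index_append[of k "[j]" w] by (simp add: lex_index_def)

lemma lex_index_less: "w \<in> words k n \<Longrightarrow> lex_index k w < k ^ n"
proof (induction n arbitrary: w)
  case 0
  then show ?case by (simp add: lex_index_def)
next
  case (Suc n)
  then obtain j u where w: "w = j # u" "j < k" "u \<in> words k n" by (auto elim: words_SucE)
  then have "lex_index k w < j * k ^ n + k ^ n"
    using Suc.IH[of u] by (simp add: lex_index_Cons length_words)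
  also have "\<dots> = Suc j * k ^ n" by simp
  also have "\<dots> \<le> k * k ^ n" using w(2) by (intro mult_right_mono) auto
  finally show ?case by simp
qed

lemma lex_word_lex_index: "w \<in> words k n \<Longrightarrow> lex_word k n (lex_index k w) = w"
proof (induction n arbitrary: w)
  case 0
  then show ?case by (simp add: lex_word_def)
next
  case (Suc n)
  then obtain u j where w: "w = u @ [j]"
    by (metis length_words length_Suc_conv_rev)
  then have "u \<in> words k n" "j < k" using Suc.prems by (auto simp: words_def)
  then show ?case using Suc.IH[of u] by (simp add: w lex_word_Suc lex_index_snoc)
qed

lemma bij_betw_lex_index:
  assumes "k > 0"
  shows "bij_betw (lex_index k) (words k n) {..<k ^ n}"
proof (rule bij_betw_byWitness[where f' = "lex_word k n"])
  show "lex_word k n ` {..<k ^ n} \<subseteq> words k n"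
    using assms by (auto simp: words_def lex_word_def)
qed (auto simp: lex_word_lex_index lex_index_lex_word lex_index_less)

section \<open>Entries and injectivity of tensor powers\<close>

lemma tensor_power_Suc: "tensor_power M (Suc n) = kron_mat M (tensor_power M n)"
  by (simp add: tensor_power_def)

lemma tensor_power_carrier:
  assumes "M \<in> carrier_mat r k"
  shows "tensor_power M n \<in> carrier_mat (r ^ n) (k ^ n)"
proof (induction n)
  case 0
  then show ?case by (simp add: tensor_power_def)
next
  case (Suc n)
  then show ?case using assms by (auto simp: tensor_power_Suc kron_mat_def)
qed

lemma tensor_power_entry:
  assumes "M \<in> carrier_mat r k" "w \<in> words r n" "c \<in> words k n"
  shows "tensor_power M n $$ (lex_index r w, lex_index k c) = prod_entries M w c"
  using assms(2,3)
proof (induction n arbitrary: w c)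
  case 0
  then show ?case by (simp add: tensor_power_def lex_index_def prod_entries_def)
next
  case (Suc n)
  obtain i u where w: "w = i # u" "i < r" "u \<in> words r n" using Suc.prems by (auto elim: words_SucE)
  obtain j d where c: "c = j # d" "j < k" "d \<in> words k n" using Suc.prems by (auto elim: words_SucE)
  have less: "lex_index r u < r ^ n" "lex_index k d < k ^ n" using lex_index_less w c by auto
  have bnd: "lex_index r w < r * r ^ n" "lex_index k c < k * k ^ n"
    using lex_index_less[OF Suc.prems(1)] lex_index_less[OF Suc.prems(2)] by auto
  have dm: "lex_index r w div r ^ n = i" "lex_index r w mod r ^ n = lex_index r u"
    "lex_index k c div k ^ n = j" "lex_index k c mod k ^ n = lex_index k d"
    using less w c by (auto simp: lex_index_Cons length_words)
  have "tensor_power M (Suc n) $$ (lex_index r w, lex_index k c) =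
      M $$ (i, j) * tensor_power M n $$ (lex_index r u, lex_index k d)"
    using bnd tensor_power_carrier[OF assms(1), of n] assms(1)
    by (auto simp: tensor_power_Suc kron_mat_def dm)
  then show ?case using Suc.IH[OF w(3) c(3)] by (simp add: w c)
qed

lemma tensor_power_apply:
  assumes M: "M \<in> carrier_mat r k" and G: "G \<in> carrier_vec (k ^ n)" and w: "w \<in> words r n" and k: "k > 0"
  shows "vec_index (tensor_power M n *\<^sub>v G) (lex_index r w) =
    (\<Sum>c\<in>words k n. prod_entries M w c * vec_index G (lex_index k c))"
proof -
  note T = tensor_power_carrier[OF M, of n]
  have "vec_index (tensor_power M n *\<^sub>v G) (lex_index r w) =
      (\<Sum>j<k ^ n. tensor_power M n $$ (lex_index r w, j) * vec_index G j)"
    using T G lex_index_less[OF w] by (simp add: scalar_prod_def lessThan_atLeast0)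
  also have "\<dots> = (\<Sum>c\<in>words k n. tensor_power M n $$ (lex_index r w, lex_index k c) * vec_index G (lex_index k c))"
    by (rule sum.reindex_bij_betw[symmetric]) (rule bij_betw_lex_index[OF k])
  finally show ?thesis by (simp add: tensor_power_entry[OF M w])
qed

text \<open>Contracting the first position of \<open>v\<close> with a row of \<open>M\<close> leaves
  a family annihilated by the remaining factors, which is zero by induction; then \<open>inj\<close>
  applies to the first position.\<close>

lemma tensor_power_inj:
  fixes v :: "nat list \<Rightarrow> complex"
  assumes inj: "\<And>x j. (\<And>i. i < r \<Longrightarrow> (\<Sum>j<k. M $$ (i, j) * x j) = 0) \<Longrightarrow> j < k \<Longrightarrow> x j = 0"
    and "\<And>w. w \<in> words r n \<Longrightarrow> (\<Sum>c\<in>words k n. prod_entries M w c * v c) = 0"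
    and "c \<in> words k n"
  shows "v c = 0"
  using assms(2,3)
proof (induction n arbitrary: v c)
  case 0
  then show ?case by (simp add: prod_entries_def)
next
  case (Suc n)
  obtain j d where c: "c = j # d" "j < k" "d \<in> words k n" using Suc.prems by (auto elim: words_SucE)
  have "(\<Sum>j<k. M $$ (i, j) * v (j # d)) = 0" if i: "i < r" for i
  proof (rule Suc.IH[OF _ c(3), of "\<lambda>d. \<Sum>j<k. M $$ (i, j) * v (j # d)"])
    fix w assume w: "w \<in> words r n"
    have "(\<Sum>d\<in>words k n. prod_entries M w d * (\<Sum>j<k. M $$ (i, j) * v (j # d))) =
        (\<Sum>d\<in>words k n. \<Sum>j<k. prod_entries M (i # w) (j # d) * v (j # d))"
      by (simp add: sum_distrib_left mult_ac)
    also have "\<dots> = (\<Sum>j<k. \<Sum>d\<in>words k n. prod_entries M (i # w) (j # d) * v (j # d))"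
      by (rule sum.swap)
    also have "\<dots> = (\<Sum>c\<in>words k (Suc n). prod_entries M (i # w) c * v c)"
      by (simp only: sum_words_Suc)
    also have "\<dots> = 0" using Suc.prems(1)[of "i # w"] i w by (simp add: Cons_words)
    finally show "(\<Sum>d\<in>words k n. prod_entries M w d * (\<Sum>j<k. M $$ (i, j) * v (j # d))) = 0" .
  qed
  then show ?case unfolding c(1) by (intro inj[of "\<lambda>j. v (j # d)"] c(2)) auto
qed

section \<open>Output positions grouped into blocks\<close>

definition bits :: "nat set \<Rightarrow> nat \<Rightarrow> nat list" where
  "bits X m = map (\<lambda>s. if s \<in> X then 1 else 0) [0..<m]"

text \<open>\<open>M\<close> has \<open>2 ^ l\<close> rows, so one letter of a row word encodes
  \<open>l\<close> consecutive outputs, here those of block \<open>s\<close>, the first most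
  significant.\<close>

definition digit :: "nat \<Rightarrow> nat set \<Rightarrow> nat \<Rightarrow> nat" where
  "digit l X s = lex_index 2 (map (\<lambda>u. if s * l + u \<in> X then 1 else 0) [0..<l])"

definition digits :: "nat \<Rightarrow> nat \<Rightarrow> nat set \<Rightarrow> nat list" where
  "digits l n X = map (digit l X) [0..<n]"

lemma bits_words: "bits X m \<in> words 2 m"
  by (auto simp: bits_def words_def)

lemma digit_less: "digit l X s < 2 ^ l"
  unfolding digit_def by (rule lex_index_less) (auto simp: words_def)

lemma digits_words: "digits l n X \<in> words (2 ^ l) n"
  by (auto simp: digits_def words_def digit_less)

text \<open>Reading a binary numeral in groups of \<open>l\<close> bits keeps its value; this
  matches the rows of the tensor power with the entries of the standard signature.\<close>

lemma lex_index_digits: "lex_index (2 ^ l) (digits l n X) = lex_index 2 (bits X (n * l))"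
proof (induction n)
  case 0
  then show ?case by (simp add: digits_def bits_def lex_index_def)
next
  case (Suc n)
  have "[0..<Suc n * l] = [0..<n * l] @ map (\<lambda>u. u + n * l) [0..<l]"
    using upt_add_eq_append[of 0 "n * l" l] by (simp add: map_add_upt add.commute)
  then have "bits X (Suc n * l) = bits X (n * l) @ map (\<lambda>u. if n * l + u \<in> X then 1 else 0) [0..<l]"
    by (simp add: bits_def add.commute)
  then have "lex_index 2 (bits X (Suc n * l)) = lex_index 2 (bits X (n * l)) * 2 ^ l + digit l X n"
    by (simp add: lex_index_append digit_def)
  moreover have "digits l (Suc n) X = digits l n X @ [digit l X n]" by (simp add: digits_def)
  ultimately show ?case using Suc by (simp add: lex_index_snoc)
qed

lemma digits_surj:
  assumes "w \<in> words (2 ^ l) n"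
  obtains X where "X \<subseteq> {..<n * l}" "digits l n X = w"
proof -
  define b where "b = lex_word 2 (n * l) (lex_index (2 ^ l) w)"
  define X where "X = {s. s < n * l \<and> b ! s = 1}"
  have b: "b \<in> words 2 (n * l)" by (auto simp: b_def words_def lex_word_def)
  have "b ! s \<in> {..<2}" if "s < n * l" for s
    using b that unfolding words_def by (metis (mono_tags, lifting) mem_Collect_eq nth_mem subsetD)
  then have "bits X (n * l) = b"
    using b by (intro nth_equalityI) (auto simp: bits_def X_def words_def less_2_cases_iff)
  moreover have "lex_index (2 ^ l) w < 2 ^ (n * l)"
    using lex_index_less[OF assms] by (simp add: power_mult[symmetric] mult.commute)
  ultimately have "lex_index (2 ^ l) (digits l n X) = lex_index (2 ^ l) w"
    unfolding lex_index_digits b_def by (simp add: lex_index_lex_word)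
  then have "digits l n X = w"
    using lex_word_lex_index[OF assms] lex_word_lex_index[OF digits_words[of l n X]] by simp
  then show thesis using that[of X] by (auto simp: X_def)
qed

lemma standard_signature_bits:
  assumes "X \<subseteq> {..<length (outs H)}"
  shows "vec_index (standard_signature H) (lex_index 2 (bits X (length (outs H)))) = signature H X"
proof -
  let ?m = "length (outs H)"
  have "lex_index 2 (bits X ?m) < 2 ^ ?m" by (rule lex_index_less[OF bits_words])
  moreover have "X = {s. s < ?m \<and> bits X ?m ! s = 1}"
    using assms by (auto simp: bits_def split: if_splits)
  then have "{outs H ! s | s. s < ?m \<and> bits X ?m ! s = 1} = (!) (outs H) ` X"
    unfolding setcompr_eq_image by (rule arg_cong[OF sym])
  ultimately show ?thesis
    by (simp add: standard_signature_def signature_def Let_def lex_word_lex_index[OF bits_words])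
qed

text \<open>Separates the row index from the column index: the outputs in the block determine letter
  \<open>t\<close>, all others the remaining letters.\<close>

lemma digits_Un_block:
  assumes t: "t < Suc n" and A: "A = {t * l..<Suc t * l}" and a: "a \<subseteq> A" and b: "b \<inter> A = {}"
  shows "digits l (Suc n) (a \<union> b) =
    insert_at t (digit l a t) (take t (digits l (Suc n) b) @ drop (Suc t) (digits l (Suc n) b))"
proof -
  have block: "s * l + u \<in> A \<longleftrightarrow> s = t" if "u < l" for s u
  proof -
    consider "s = t" | "Suc s \<le> t" | "Suc t \<le> s" by linarith
    then show ?thesis
    proof cases
      case 2
      then have "Suc s * l \<le> t * l" by (rule mult_right_mono) simp
      then show ?thesis using 2 that by (simp add: A)
    next
      case 3
      then have "Suc t * l \<le> s * l" by (rule mult_right_mono) simp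
      then show ?thesis using 3 by (simp add: A)
    qed (use that in \<open>simp add: A\<close>)
  qed
  have "digit l (a \<union> b) t = digit l a t"
    unfolding digit_def using block[of _ t] b
    by (intro arg_cong[where f = "lex_index 2"] map_cong) auto
  moreover have "digit l (a \<union> b) s = digit l b s" if "s \<noteq> t" for s
    unfolding digit_def using block[of _ s] a that
    by (intro arg_cong[where f = "lex_index 2"] map_cong) auto
  ultimately have "take t (digits l (Suc n) (a \<union> b)) = take t (digits l (Suc n) b)"
    "drop (Suc t) (digits l (Suc n) (a \<union> b)) = drop (Suc t) (digits l (Suc n) b)"
    "digits l (Suc n) (a \<union> b) ! t = digit l a t"
    using t by (simp_all add: digits_def take_map drop_map del: upt_Suc)
  then show ?thesis
    using t id_take_nth_drop[of t "digits l (Suc n) (a \<union> b)"]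
    by (simp add: insert_at_def digits_def del: upt_Suc)
qed

section \<open>Impossibility on domain size three\<close>

theorem theorem5p2:
  fixes G :: "complex Matrix.vec" and n :: nat
  assumes "G \<in> carrier_vec (3 ^ n)"
    and "full_rank_signature 3 n G"
  shows "\<forall>l\<ge>1. \<forall>M \<in> carrier_mat (2 ^ l) 3. vec_space.rank (2 ^ l) M = 3 \<longrightarrow>
    \<not> (\<exists>H :: 'v gate. realized_by n G M H)"
proof (intro allI impI ballI notI)
  fix l :: nat and M :: "complex mat"
  assume M: "M \<in> carrier_mat (2 ^ l) 3" and rankM: "vec_space.rank (2 ^ l) M = 3"
    and "\<exists>H :: 'v gate. realized_by n G M H"
  then obtain H :: "'v gate" where gate: "generator_matchgate H"
    and eq: "tensor_power M n *\<^sub>v G = standard_signature H"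
    unfolding realized_by_def by blast
  obtain t where t: "t < n" and rankG: "vec_space.rank 3 (unfolding_mat 3 n G t) = 3"
    using assms(2) by (auto simp: full_rank_signature_def)
  obtain n' where n: "n = Suc n'" using t by (cases n) auto
  define m where "m = length (outs H)"
  \<comment> \<open>The number of outputs is not given; it follows by comparing dimensions.\<close>
  have "(2 ^ l) ^ n = (2 :: nat) ^ m"
    using arg_cong[OF eq, of dim_vec] tensor_power_carrier[OF M, of n]
    by (auto simp: standard_signature_def Let_def m_def)
  then have m: "m = n * l" by (simp add: power_mult[symmetric] mult.commute)
  let ?f = "signature H"
  define A where "A = {t * l..<Suc t * l}"
  define B where "B = {..<m} - A"
  have hi: "Suc t * l \<le> m" unfolding m using t by (intro mult_right_mono) auto
  define others where "others = (\<lambda>b. take t (digits l n b) @ drop (Suc t) (digits l n b))"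
  have oth: "others b \<in> words (2 ^ l) n'" for b
    using digits_words[of l n b] t unfolding n others_def words_def
    by (auto dest: in_set_takeD in_set_dropD)
  \<comment> \<open>The unfolding of \<open>G\<close> at \<open>t\<close>, its columns named by
    words.\<close>
  define g where "g = (\<lambda>j d. vec_index G (lex_index 3 (insert_at t j d)))"
  have tn: "t \<le> n'" using t n by simp
  \<comment> \<open>Splitting column words at position \<open>t\<close> leaves one factor
    \<open>M\<close> on the row side and the tensor power on the other positions on the column
    side.\<close>
  have fac: "?f (a \<union> b) = (\<Sum>j<3. M $$ (digit l a t, j) * (\<Sum>d\<in>words 3 n'. prod_entries M (others b) d * g j d))"
    if a: "a \<subseteq> A" and b: "b \<subseteq> B" for a b
  proof -
    have sub: "a \<union> b \<subseteq> {..<m}" using a b hi by (auto simp: A_def B_def)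
    have dg: "digits l n (a \<union> b) = insert_at t (digit l a t) (others b)"
      unfolding n others_def by (rule digits_Un_block[OF _ A_def a]) (use t n b B_def in auto)
    have "?f (a \<union> b) = vec_index (tensor_power M n *\<^sub>v G) (lex_index (2 ^ l) (digits l n (a \<union> b)))"
      using standard_signature_bits[of "a \<union> b" H] sub unfolding eq lex_index_digits m_def[symmetric] m
      by simp
    also have "\<dots> = (\<Sum>c\<in>words 3 n. prod_entries M (digits l n (a \<union> b)) c * vec_index G (lex_index 3 c))"
      by (rule tensor_power_apply[OF M assms(1) digits_words]) simp
    also have "\<dots> = (\<Sum>j<3. \<Sum>d\<in>words 3 n'. prod_entries M (digits l n (a \<union> b)) (insert_at t j d) * g j d)"
      unfolding n g_def by (rule sum_words_insert_at[OF tn])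
    also have "\<dots> = (\<Sum>j<3. \<Sum>d\<in>words 3 n'. M $$ (digit l a t, j) * (prod_entries M (others b) d * g j d))"
      unfolding dg using length_words[OF oth] tn
      by (intro sum.cong refl) (simp add: prod_entries_insert_at length_words)
    finally show ?thesis by (simp add: sum_distrib_left)
  qed
  have Minj: "x j = 0" if x: "\<And>i. i < 2 ^ l \<Longrightarrow> (\<Sum>j<3. M $$ (i, j) * x j) = 0" and j: "j < 3"
    for x :: "nat \<Rightarrow> complex" and j
  proof -
    have "Matrix.vec 3 x = 0\<^sub>v 3"
      by (rule full_col_rank_inj[OF M rankM])
        (use M x in \<open>auto intro!: eq_vecI simp: scalar_prod_def lessThan_atLeast0\<close>)
    then show ?thesis using j by (metis index_vec index_zero_vec(1))
  qed
  have Ginj: "x j = 0" if x: "\<And>d. d \<in> words 3 n' \<Longrightarrow> (\<Sum>j<3. x j * g j d) = 0" and j: "j < 3"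
    for x :: "nat \<Rightarrow> complex" and j
  proof -
    have U: "unfolding_mat 3 n G t \<in> carrier_mat 3 (3 ^ n')" by (simp add: unfolding_mat_def n)
    have "Matrix.vec 3 x = 0\<^sub>v 3"
    proof (rule full_row_rank_inj[OF U rankG])
      fix c :: nat assume c: "c < 3 ^ n'"
      have "lex_word 3 n' c \<in> words 3 n'" by (auto simp: words_def lex_word_def)
      from x[OF this] show "col (unfolding_mat 3 n G t) c \<bullet> Matrix.vec 3 x = 0"
        using U c by (simp add: scalar_prod_def lessThan_atLeast0 unfolding_mat_def n Let_def g_def
            insert_at_def mult.commute)
    qed simp
    then show ?thesis using j by (metis index_vec index_zero_vec(1))
  qed
  \<comment> \<open>Subsets of \<open>A\<close> and of \<open>B\<close> reach all letters and all
    remaining words independently, so injectivity over words carries over to sets of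
    outputs.\<close>
  have row_surj: "\<exists>a\<subseteq>A. digit l a t = i \<and> (\<exists>b\<subseteq>B. others b = w)"
    if "i < 2 ^ l" "w \<in> words (2 ^ l) n'" for i w
  proof -
    have "insert_at t i w \<in> words (2 ^ l) n" unfolding n by (rule insert_at_words[OF tn that])
    then obtain X where X: "X \<subseteq> {..<n * l}" "digits l n X = insert_at t i w" by (rule digits_surj)
    have "digits l n ((X \<inter> A) \<union> (X - A)) = insert_at t (digit l (X \<inter> A) t) (others (X - A))"
      unfolding n others_def by (rule digits_Un_block[OF _ A_def]) (use t n in auto)
    moreover have "(X \<inter> A) \<union> (X - A) = X" by blast
    ultimately have e: "insert_at t (digit l (X \<inter> A) t) (others (X - A)) = insert_at t i w"
      using X(2) by simp
    have "length (others (X - A)) = length w" using length_words[OF oth] length_words[OF that(2)] by simp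
    then have "digit l (X \<inter> A) t = i \<and> others (X - A) = w"
      using e length_words[OF that(2)] tn
      by (auto simp: insert_at_def) (metis append_take_drop_id)
    moreover have "X - A \<subseteq> B" using X(1) by (auto simp: B_def m)
    ultimately show ?thesis by blast
  qed
  show False
  proof (rule no_rank_3_factorization[of m ?f "card (verts H)" A "t * l" "Suc t * l" B
        "\<lambda>a j. M $$ (digit l a t, j)" "\<lambda>j b. \<Sum>d\<in>words 3 n'. prod_entries M (others b) d * g j d"])
    show "(\<Sum>p\<in>sym_diff S T. (-1) ^ card {s \<in> sym_diff S T. s < p} *
        (?f (sym_diff S {p}) * ?f (sym_diff T {p}))) = 0" if "S \<subseteq> {..<m}" "T \<subseteq> {..<m}" for S T
      using matchgate_identity[OF gate] that unfolding m_def by blast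
    show "even (card (verts H) + card X)" if "X \<subseteq> {..<m}" "?f X \<noteq> 0" for X
      using signature_parity[OF gate] that unfolding m_def by blast
    show "?f (a \<union> b) = (\<Sum>j<3. M $$ (digit l a t, j) * (\<Sum>d\<in>words 3 n'. prod_entries M (others b) d * g j d))"
      if "a \<subseteq> A" "b \<subseteq> B" for a b by (rule fac[OF that])
    show "x j = 0" if x: "\<And>a. a \<subseteq> A \<Longrightarrow> (\<Sum>j<3. M $$ (digit l a t, j) * x j) = 0" and j: "j < 3" for x j
    proof (rule Minj[OF _ j])
      fix i :: nat assume "i < 2 ^ l"
      \<comment> \<open>Only letter \<open>t\<close> matters here; \<open>others {}\<close> merely
        supplies some word for the rest.\<close>
      then obtain a where "a \<subseteq> A" "digit l a t = i" using row_surj[OF _ oth[of "{}"]] by blast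
      then show "(\<Sum>j<3. M $$ (i, j) * x j) = 0" using x by blast
    qed
    show "x j = 0" if x: "\<And>b. b \<subseteq> B \<Longrightarrow> (\<Sum>j<3. x j * (\<Sum>d\<in>words 3 n'. prod_entries M (others b) d * g j d)) = 0"
      and j: "j < 3" for x j
    proof (rule Ginj[OF _ j])
      fix d assume d: "d \<in> words 3 n'"
      show "(\<Sum>j<3. x j * g j d) = 0"
      \<comment> \<open>Injectivity on the remaining \<open>n'\<close> positions removes the tensor
        power and leaves the unfolding of \<open>G\<close>, whose full row rank \<open>Ginj\<close>
        expresses.\<close>
      proof (rule tensor_power_inj[where r = "2 ^ l" and k = 3 and n = n' and M = M and c = d and
            v = "\<lambda>d. \<Sum>j<3. x j * g j d", OF _ _ d])
        show "y j = 0" if "\<And>i. i < 2 ^ l \<Longrightarrow> (\<Sum>j<3. M $$ (i, j) * y j) = 0" "j < 3" for y j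
          by (rule Minj[OF that])
      next
        fix w assume "w \<in> words (2 ^ l) n'"
        then obtain b where b: "b \<subseteq> B" "others b = w" using row_surj[of 0 w] by auto
        have "(\<Sum>c\<in>words 3 n'. prod_entries M w c * (\<Sum>j<3. x j * g j c)) =
            (\<Sum>c\<in>words 3 n'. \<Sum>j<3. x j * (prod_entries M w c * g j c))"
          by (simp add: sum_distrib_left mult_ac)
        also have "\<dots> = (\<Sum>j<3. \<Sum>c\<in>words 3 n'. x j * (prod_entries M w c * g j c))"
          by (rule sum.swap)
        also have "\<dots> = 0" using x[OF b(1)] b(2) by (simp add: sum_distrib_left)
        finally show "(\<Sum>c\<in>words 3 n'. prod_entries M w c * (\<Sum>j<3. x j * g j c)) = 0" .
      qed
    qed
  qed (use hi in \<open>simp_all add: A_def B_def\<close>)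
qed

end
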